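(* Consider the dynamics $$\frac{d}{dt}q=\tfrac12\,q*\omega,\qquad \frac{d}{dt}v=v\times\omega+q^{-1}*\mathbf{A}*q+a,$$ with state $(q,v)\in\mathbb{H}_1\times\mathbb{R}^3$, known inputs $\omega(t),a(t)\in\mathbb{R}^3$ and measured output $(y_v,y_b)=(v,\,q^{-1}*\mathbf{B}*q)$. Consider the non-linear observer $$\frac{d}{dt}\hat q=\tfrac12\,\hat q*\omega(t)+(\bar{\mathcal L}^q_vE_v+\bar{\mathcal L}^q_bE_b)*\hat q,$$ $$\frac{d}{dt}\hat v=\hat v\times\omega(t)+\hat q^{-1}*\mathbf{A}*\hat q+a(t)+\hat q^{-1}*(\bar{\mathcal L}^v_vE_v+\bar{\mathcal L}^v_bE_b)*\hat q,$$ with $$E_v=\hat q*(\hat v-y_v(t))*\hat q^{-1},\qquad E_b=\mathbf{B}-\hat q*y_b(t)*\hat q^{-1},$$ and with the constant gain matrices $$\bar{\mathcal L}^q_v=\begin{pmatrix}0&-M_{12}&0\\ M_{21}&0&0\\ 0&0&0\end{pmatrix},\quad \bar{\mathcal L}^v_v=-\begin{pmatrix}N_{11}&0&0\\ 0&N_{22}&0\\ 0&0&N_{33}\end{pmatrix},\quad \bar{\mathcal L}^q_b=\begin{pmatrix}0&0&0\\ 0&0&0\\ -\lambda\mathbf{B}^2&\lambda\mathbf{B}^1&0\end{pmatrix},\quad \bar{\mathcal L}^v_b=0,$$ where the real constants $M_{12},M_{21},N_{11},N_{22},N_{33},\lambda$ are chosen such that the following linear systems are asymptotically stable: - the longitudinal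 subsystem $\frac{d}{dt}\begin{pmatrix}\delta\eta_q^2\\ \delta\eta_v^1\end{pmatrix}=\begin{pmatrix}0&M_{21}\\ -2a_{grav}&-N_{11}\end{pmatrix}\begin{pmatrix}\delta\eta_q^2\\ \delta\eta_v^1\end{pmatrix}$; - the lateral subsystem $\frac{d}{dt}\begin{pmatrix}\delta\eta_q^1\\ \delta\eta_v^2\end{pmatrix}=\begin{pmatrix}0&-M_{12}\\ 2a_{grav}&-N_{22}\end{pmatrix}\begin{pmatrix}\delta\eta_q^1\\ \delta\eta_v^2\end{pmatrix}$; - the vertical subsystem $\frac{d}{dt}\delta\eta_v^3=-N_{33}\,\delta\eta_v^3$; - the heading subsystem $\frac{d}{dt}\delta\eta_q^3=2\lambda\mathbf{B}^3(\mathbf{B}^1\delta\eta_q^1+\mathbf{B}^2\delta\eta_q^2)-2\lambda\bigl((\mathbf{B}^1)^2+(\mathbf{B}^2)^2\bigr)\delta\eta_q^3$ (in which $\delta\eta_q^1,\delta\eta_q^2$ act as inputs). Then the observer converges locally and exponentially around any system trajectory. The invariant estimation state error $\eta_q=\hat q*q^{-1}$, $\eta_v=q*(\hat v-v)*q^{-1}$ obeys the autonomous differential equation $$\frac{d}{dt}\eta_q=\bigl[\bar{\mathcal L}^q_v(\eta_q*\eta_v*\eta_q^{-1})+\bar{\mathcal L}^q_b(\mathbf{B}-\eta_q*\mathbf{B}*\eta_q^{-1})\bigr]*\eta_q,$$ $$\frac{d}{dt}\eta_v=\eta_q^{-1}*\bigl[\mathbf{A}+\bar{\mathcal L}^v_v(\eta_q*\eta_v*\eta_q^{-1})+\bar{\mathcal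 L}^v_b(\mathbf{B}-\eta_q*\mathbf{B}*\eta_q^{-1})\bigr]*\eta_q-\mathbf{A}.$$ The convergence behavior and Lyapunov exponents are completely independent of the system trajectory and of the inputs.
   Context: Quaternions are written $q=q^0+q^1e_1+q^2e_2+q^3e_3$ with product $*$ given by $e_1*e_1=e_2*e_2=e_3*e_3=-1$, $e_1*e_2=-e_2*e_1=e_3$ and circular permutations; $\mathbb{H}_1$ is the group of quaternions of norm $1$. A vector $p=(p^1,p^2,p^3)\in\mathbb{R}^3$ is identified with the quaternion $p^1e_1+p^2e_2+p^3e_3$; the cross product then reads $v\times\omega=(v*\omega-\omega*v)/2$, and $3\times3$ matrices act on $\mathbb{R}^3$ (imaginary quaternions) in the usual way. For $q\in\mathbb{H}_1$ and $p\in\mathbb{R}^3$ one has $q^{-1}*p*q\in\mathbb{R}^3$. $\mathbf{A}=(0,0,a_{grav})\in\mathbb{R}^3$ is the constant gravity vector and $\mathbf{B}=(\mathbf{B}^1,\mathbf{B}^2,\mathbf{B}^3)\in\mathbb{R}^3$ the constant Earth magnetic field (superscripts denote components), both in the Earth-fixed frame. The observer state is $(\hat q,\hat v)\in\mathbb{H}_1\times\mathbb{R}^3$. Locally exponentially convergent around a system trajectory means: if the initial estimate $(\hat q(0),\hat v(0))$ is sufficiently close to $(q(0),v(0))$, i.e. $(\eta_q(0),\eta_v(0))$ is sufficiently close to $(1,0)$, then $(\eta_q(t),\eta_v(t))\to(1,0)$ exponentially as $t\to+\infty$. The variables $\delta\eta_q^i,\delta\eta_v^i$ ($i=1,2,3$)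 denote the coordinates of the error linearized about $(\eta_q,\eta_v)=(1,0)$, with $\delta\eta_q=(\delta\eta_q^1,\delta\eta_q^2,\delta\eta_q^3)$ and $\delta\eta_v=(\delta\eta_v^1,\delta\eta_v^2,\delta\eta_v^3)$. *)

theory Defs
  imports "HOL-Analysis.Analysis"
begin

section \<open>Quaternions\<close>

codatatype quat = Quat (q0: real) (q1: real) (q2: real) (q3: real)

lemma quat_eq_iff: "x = y \<longleftrightarrow> q0 x = q0 y \<and> q1 x = q1 y \<and> q2 x = q2 y \<and> q3 x = q3 y"
  by (auto intro: quat.expand)

instantiation quat :: ab_group_add
begin

primcorec zero_quat where
  "q0 0 = 0" | "q1 0 = 0" | "q2 0 = 0" | "q3 0 = 0"

primcorec plus_quat where
  "q0 (x + y) = q0 x + q0 y"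
| "q1 (x + y) = q1 x + q1 y"
| "q2 (x + y) = q2 x + q2 y"
| "q3 (x + y) = q3 x + q3 y"

primcorec uminus_quat where
  "q0 (- x) = - q0 x"
| "q1 (- x) = - q1 x"
| "q2 (- x) = - q2 x"
| "q3 (- x) = - q3 x"

primcorec minus_quat where
  "q0 (x - y) = q0 x - q0 y"
| "q1 (x - y) = q1 x - q1 y"
| "q2 (x - y) = q2 x - q2 y"
| "q3 (x - y) = q3 x - q3 y"

instance
  by standard (simp_all add: quat_eq_iff)

end

instantiation quat :: ring_1
begin

primcorec one_quat where
  "q0 1 = 1" | "q1 1 = 0" | "q2 1 = 0" | "q3 1 = 0"

primcorec times_quat where
  "q0 (x * y) = q0 x * q0 y - q1 x * q1 y - q2 x * q2 y - q3 x * q3 y"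
| "q1 (x * y) = q0 x * q1 y + q1 x * q0 y + q2 x * q3 y - q3 x * q2 y"
| "q2 (x * y) = q0 x * q2 y - q1 x * q3 y + q2 x * q0 y + q3 x * q1 y"
| "q3 (x * y) = q0 x * q3 y + q1 x * q2 y - q2 x * q1 y + q3 x * q0 y"

instance
  by standard (simp_all add: quat_eq_iff algebra_simps)

end

lemma quat_unit_products:
  fixes e1 e2 e3 :: quat
  defines "e1 \<equiv> Quat 0 1 0 0" and "e2 \<equiv> Quat 0 0 1 0" and "e3 \<equiv> Quat 0 0 0 1"
  shows "e1 * e1 = - 1" "e2 * e2 = - 1" "e3 * e3 = - 1"
    "e1 * e2 = e3" "e2 * e1 = - e3"
    "e2 * e3 = e1" "e3 * e2 = - e1"
    "e3 * e1 = e2" "e1 * e3 = - e2"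
  by (simp_all add: e1_def e2_def e3_def quat_eq_iff)

instantiation quat :: real_algebra_1
begin

primcorec scaleR_quat where
  "q0 (r *\<^sub>R x) = r * q0 x"
| "q1 (r *\<^sub>R x) = r * q1 x"
| "q2 (r *\<^sub>R x) = r * q2 x"
| "q3 (r *\<^sub>R x) = r * q3 x"

instance
  by standard (simp_all add: quat_eq_iff algebra_simps)

end

lemma sum_four_squares_eq_0_iff:
  fixes a b c d :: real
  shows "a\<^sup>2 + b\<^sup>2 + c\<^sup>2 + d\<^sup>2 = 0 \<longleftrightarrow> a = 0 \<and> b = 0 \<and> c = 0 \<and> d = 0"
  by (auto simp: add_nonneg_eq_0_iff)

instantiation quat :: real_div_algebra
begin

primcorec inverse_quat where
  "q0 (inverse x) = q0 x / ((q0 x)\<^sup>2 + (q1 x)\<^sup>2 + (q2 x)\<^sup>2 + (q3 x)\<^sup>2)"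
| "q1 (inverse x) = - q1 x / ((q0 x)\<^sup>2 + (q1 x)\<^sup>2 + (q2 x)\<^sup>2 + (q3 x)\<^sup>2)"
| "q2 (inverse x) = - q2 x / ((q0 x)\<^sup>2 + (q1 x)\<^sup>2 + (q2 x)\<^sup>2 + (q3 x)\<^sup>2)"
| "q3 (inverse x) = - q3 x / ((q0 x)\<^sup>2 + (q1 x)\<^sup>2 + (q2 x)\<^sup>2 + (q3 x)\<^sup>2)"

definition "x div y = x * inverse y" for x y :: quat

instance
proof
  fix x y :: quat
  show "x \<noteq> 0 \<Longrightarrow> inverse x * x = 1" "x \<noteq> 0 \<Longrightarrow> x * inverse x = 1"
  proof -
    assume "x \<noteq> 0"
    then have N: "(q0 x)\<^sup>2 + (q1 x)\<^sup>2 + (q2 x)\<^sup>2 + (q3 x)\<^sup>2 \<noteq> 0"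
      by (simp add: sum_four_squares_eq_0_iff quat_eq_iff)
    define n where "n = (q0 x)\<^sup>2 + (q1 x)\<^sup>2 + (q2 x)\<^sup>2 + (q3 x)\<^sup>2"
    define c where "c = Quat (q0 x) (- q1 x) (- q2 x) (- q3 x)"
    have inv: "inverse x = (1 / n) *\<^sub>R c"
      by (simp add: quat_eq_iff c_def n_def)
    have "c * x = n *\<^sub>R 1" "x * c = n *\<^sub>R 1"
      by (simp_all add: quat_eq_iff c_def n_def power2_eq_square)
    then show "inverse x * x = 1" "x * inverse x = 1"
      using N by (simp_all add: inv n_def [symmetric])
  qed
  show "inverse (0::quat) = 0"
    by (simp add: quat_eq_iff)
  show "x div y = x * inverse y"
    by (rule divide_quat_def)
qed

end

instantiation quat :: real_inner
begin

definition "x \<bullet> y = q0 x * q0 y + q1 x * q1 y + q2 x * q2 y + q3 x * q3 y" for x y :: quat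
definition "norm x = sqrt ((q0 x)\<^sup>2 + (q1 x)\<^sup>2 + (q2 x)\<^sup>2 + (q3 x)\<^sup>2)" for x :: quat
definition "sgn x = x /\<^sub>R norm x" for x :: quat
definition "dist x y = norm (x - y)" for x y :: quat
definition [code del]:
  "(uniformity :: (quat \<times> quat) filter) = (INF e\<in>{0 <..}. principal {(x, y). dist x y < e})"
definition [code del]:
  "open (U :: quat set) \<longleftrightarrow> (\<forall>x\<in>U. eventually (\<lambda>(x', y). x' = x \<longrightarrow> y \<in> U) uniformity)"

instance
proof
  fix r :: real and x y z :: quat and U :: "quat set"
  show "sgn x = x /\<^sub>R norm x" by (rule sgn_quat_def)
  show "dist x y = norm (x - y)" by (rule dist_quat_def)
  show "(uniformity :: (quat \<times> quat) filter) = (INF e\<in>{0 <..}. principal {(x, y). dist x y < e})"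
    by (rule uniformity_quat_def)
  show "open U \<longleftrightarrow> (\<forall>x\<in>U. eventually (\<lambda>(x', y). x' = x \<longrightarrow> y \<in> U) uniformity)"
    by (rule open_quat_def)
  show "x \<bullet> y = y \<bullet> x" "(x + y) \<bullet> z = x \<bullet> z + y \<bullet> z" "(r *\<^sub>R x) \<bullet> y = r * (x \<bullet> y)" "0 \<le> x \<bullet> x"
    by (simp_all add: inner_quat_def algebra_simps)
  show "x \<bullet> x = 0 \<longleftrightarrow> x = 0"
    using sum_four_squares_eq_0_iff [of "q0 x" "q1 x" "q2 x" "q3 x"]
    by (simp add: inner_quat_def quat_eq_iff power2_eq_square)
  show "norm x = sqrt (x \<bullet> x)"
    by (simp add: inner_quat_def norm_quat_def power2_eq_square)
qed

end

lemma four_square_identity: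
  fixes a b c d e f g h :: real
  shows "(a * e - b * f - c * g - d * h)\<^sup>2 + (a * f + b * e + c * h - d * g)\<^sup>2
    + (a * g - b * h + c * e + d * f)\<^sup>2 + (a * h + b * g - c * f + d * e)\<^sup>2
    = (a\<^sup>2 + b\<^sup>2 + c\<^sup>2 + d\<^sup>2) * (e\<^sup>2 + f\<^sup>2 + g\<^sup>2 + h\<^sup>2)"
  by algebra

instance quat :: real_normed_div_algebra
proof
  show "norm (x * y) = norm x * norm y" for x y :: quat
    unfolding norm_quat_def times_quat.sel four_square_identity real_sqrt_mult by (rule refl)
qed

instantiation quat :: euclidean_space
begin

definition "Basis = {Quat 1 0 0 0, Quat 0 1 0 0, Quat 0 0 1 0, Quat 0 0 0 1}"

instance
proof
  show "(Basis :: quat set) \<noteq> {}" "finite (Basis :: quat set)"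
    by (simp_all add: Basis_quat_def)
  show "u \<bullet> v = (if u = v then 1 else 0)" if "u \<in> Basis" "v \<in> Basis" for u v :: quat
    using that unfolding Basis_quat_def by (elim insertE emptyE) (simp_all add: inner_quat_def)
  show "(\<forall>u\<in>Basis. x \<bullet> u = 0) \<longleftrightarrow> x = 0" for x :: quat
    by (simp add: Basis_quat_def inner_quat_def) (simp add: quat_eq_iff)
qed

end

text \<open>The identification of \<open>\<real>\<^sup>3\<close> with the imaginary quaternions, and its left inverse.\<close>

definition imq :: "real^3 \<Rightarrow> quat" where
  "imq p = Quat 0 (p$1) (p$2) (p$3)"

definition vecq :: "quat \<Rightarrow> real^3" where
  "vecq q = vector [q1 q, q2 q, q3 q]"

lemma vecq_imq [simp]: "vecq (imq p) = p"
  by (simp add: vecq_def imq_def vec_eq_iff forall_3)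

lemma imq_vecq: "q0 q = 0 \<Longrightarrow> imq (vecq q) = q"
  by (simp add: vecq_def imq_def quat_eq_iff)

lemma imq_cross3: "imq (cross3 u w) = (imq u * imq w - imq w * imq u) /\<^sub>R 2"
  by (simp add: imq_def cross3_def quat_eq_iff)

text \<open>
  Conjugation preserves imaginary quaternions, so \<^const>\<open>vecq\<close> loses no information wherever it
  is applied to a conjugate of an imaginary quaternion below.
\<close>

lemma imq_vecq_conjugate:
  "imq (vecq (q * imq p * inverse q)) = q * imq p * inverse q"
  "imq (vecq (inverse q * imq p * q)) = inverse q * imq p * q"
proof -
  define n where "n = (q0 q)\<^sup>2 + (q1 q)\<^sup>2 + (q2 q)\<^sup>2 + (q3 q)\<^sup>2"
  define c where "c = Quat (q0 q) (- q1 q) (- q2 q) (- q3 q)"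
  have inv: "inverse q = (1 / n) *\<^sub>R c"
    by (simp add: quat_eq_iff c_def n_def)
  have "q0 (q * imq p * c) = 0" "q0 (c * imq p * q) = 0"
    by (simp_all add: imq_def c_def algebra_simps)
  then have "q0 (q * imq p * inverse q) = 0" "q0 (inverse q * imq p * q) = 0"
    unfolding inv mult_scaleR_right mult_scaleR_left scaleR_quat.sel by simp_all
  then show "imq (vecq (q * imq p * inverse q)) = q * imq p * inverse q"
    "imq (vecq (inverse q * imq p * q)) = inverse q * imq p * q"
    by (simp_all only: imq_vecq)
qed

section \<open>Differential equations\<close>

definition ode_solution ::
    "'a set \<Rightarrow> (real \<Rightarrow> 'a \<Rightarrow> 'a) \<Rightarrow> (real \<Rightarrow> 'a::real_normed_vector) \<Rightarrow> bool" where
  "ode_solution S F x \<longleftrightarrow>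
     (\<forall>t\<ge>0. x t \<in> S \<and> (x has_vector_derivative F t (x t)) (at t within {0..}))"

text \<open>
  Only applied to linear vector fields, whose solutions all exist on \<open>[0,\<infinity>)\<close>.
\<close>

definition asymptotically_stable :: "('a \<Rightarrow> 'a::real_normed_vector) \<Rightarrow> bool" where
  "asymptotically_stable f \<longleftrightarrow>
     (\<forall>\<epsilon>>0. \<exists>\<delta>>0. \<forall>x. ode_solution UNIV (\<lambda>_. f) x \<and> norm (x 0) < \<delta> \<longrightarrow> (\<forall>t\<ge>0. norm (x t) < \<epsilon>)) \<and>
     (\<exists>\<delta>>0. \<forall>x. ode_solution UNIV (\<lambda>_. f) x \<and> norm (x 0) < \<delta> \<longrightarrow> (x \<longlongrightarrow> 0) at_top)"

section \<open>System, observer and invariant error\<close>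

type_synonym state = "quat \<times> (real^3)"

definition state_space :: "state set" where
  "state_space = {x. norm (fst x) = 1}"

definition system_field ::
    "real^3 \<Rightarrow> (real \<Rightarrow> real^3) \<Rightarrow> (real \<Rightarrow> real^3) \<Rightarrow> real \<Rightarrow> state \<Rightarrow> state" where
  "system_field A \<omega> a t = (\<lambda>(q, v).
     ((1/2) *\<^sub>R (q * imq (\<omega> t)),
      cross3 v (\<omega> t) + vecq (inverse q * imq A * q) + a t))"

definition system_output :: "real^3 \<Rightarrow> state \<Rightarrow> (real^3) \<times> (real^3)" where
  "system_output B = (\<lambda>(q, v). (v, vecq (inverse q * imq B * q)))"

definition observer_field ::
    "real^3 \<Rightarrow> real^3 \<Rightarrow> real^3^3 \<Rightarrow> real^3^3 \<Rightarrow> real^3^3 \<Rightarrow> real^3^3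
     \<Rightarrow> (real \<Rightarrow> real^3) \<Rightarrow> (real \<Rightarrow> real^3) \<Rightarrow> (real \<Rightarrow> (real^3) \<times> (real^3)) \<Rightarrow> real \<Rightarrow> state \<Rightarrow> state" where
  "observer_field A B Lqv Lqb Lvv Lvb \<omega> a y t = (\<lambda>(qh, vh).
     let Ev = vecq (qh * imq (vh - fst (y t)) * inverse qh);
         Eb = B - vecq (qh * imq (snd (y t)) * inverse qh)
     in ((1/2) *\<^sub>R (qh * imq (\<omega> t)) + imq (Lqv *v Ev + Lqb *v Eb) * qh,
         cross3 vh (\<omega> t) + vecq (inverse qh * imq A * qh) + a t
           + vecq (inverse qh * imq (Lvv *v Ev + Lvb *v Eb) * qh)))"

definition inv_error :: "state \<Rightarrow> state \<Rightarrow> state" where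
  "inv_error x xh =
     (fst xh * inverse (fst x),
      vecq (fst x * imq (snd xh - snd x) * inverse (fst x)))"

definition error_field ::
    "real^3 \<Rightarrow> real^3 \<Rightarrow> real^3^3 \<Rightarrow> real^3^3 \<Rightarrow> real^3^3 \<Rightarrow> real^3^3 \<Rightarrow> state \<Rightarrow> state" where
  "error_field A B Lqv Lqb Lvv Lvb = (\<lambda>(eq, ev).
     let Ev = vecq (eq * imq ev * inverse eq);
         Eb = B - vecq (eq * imq B * inverse eq)
     in (imq (Lqv *v Ev + Lqb *v Eb) * eq,
         vecq (inverse eq * imq (A + Lvv *v Ev + Lvb *v Eb) * eq) - A))"

text \<open>
  The arguments \<open>u1\<close>, \<open>u2\<close> of the heading subsystem are its inputs, the first two components of
  the linearized angular error. Its stability is that of the unforced system.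
\<close>

definition longitudinal_field :: "real \<Rightarrow> real \<Rightarrow> real \<Rightarrow> real^2 \<Rightarrow> real^2" where
  "longitudinal_field a_grav M21 N11 z =
     (vector [vector [0, M21], vector [- 2 * a_grav, - N11]] :: real^2^2) *v z"

definition lateral_field :: "real \<Rightarrow> real \<Rightarrow> real \<Rightarrow> real^2 \<Rightarrow> real^2" where
  "lateral_field a_grav M12 N22 z =
     (vector [vector [0, - M12], vector [2 * a_grav, - N22]] :: real^2^2) *v z"

definition vertical_field :: "real \<Rightarrow> real \<Rightarrow> real" where
  "vertical_field N33 z = - N33 * z"

definition heading_field :: "real^3 \<Rightarrow> real \<Rightarrow> real \<Rightarrow> real \<Rightarrow> real \<Rightarrow> real" where
  "heading_field B lam u1 u2 z =
     2 * lam * B$3 * (B$1 * u1 + B$2 * u2) - 2 * lam * ((B$1)\<^sup>2 + (B$2)\<^sup>2) * z"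

section \<open>Exponential convergence and Lyapunov exponents\<close>

text \<open>
  \<open>F\<close> is the vector field of the observer fed with the inputs and outputs along the system
  trajectory \<open>x\<close>. Every estimate starting within distance \<open>\<epsilon>\<close> (measured by the invariant error)
  extends to a solution on \<open>[0,\<infinity>)\<close>, and every such solution converges with gain \<open>C\<close> and rate \<open>\<mu>\<close>.
\<close>

definition exp_convergent_around ::
    "real \<Rightarrow> real \<Rightarrow> real \<Rightarrow> (real \<Rightarrow> state \<Rightarrow> state) \<Rightarrow> (real \<Rightarrow> state) \<Rightarrow> bool" where
  "exp_convergent_around \<epsilon> C \<mu> F x \<longleftrightarrow>
     (\<forall>z\<in>state_space. dist (inv_error (x 0) z) (1, 0) < \<epsilon> \<longrightarrow>
        (\<exists>xh. ode_solution state_space F xh \<and> xh 0 = z)) \<and>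
     (\<forall>xh. ode_solution state_space F xh \<and> dist (inv_error (x 0) (xh 0)) (1, 0) < \<epsilon> \<longrightarrow>
        (\<forall>t\<ge>0. dist (inv_error (x t) (xh t)) (1, 0)
                 \<le> C * exp (- \<mu> * t) * dist (inv_error (x 0) (xh 0)) (1, 0)))"

text \<open>
  Solutions of the variational equation of \<open>F\<close> along \<open>x\<close> that are tangent to the state space.
\<close>

definition variational_solution ::
    "(real \<Rightarrow> state \<Rightarrow> state) \<Rightarrow> (real \<Rightarrow> state) \<Rightarrow> (real \<Rightarrow> state) \<Rightarrow> bool" where
  "variational_solution F x \<delta> \<longleftrightarrow>
     (\<forall>t\<ge>0. fst (x t) \<bullet> fst (\<delta> t) = 0 \<and>
        (\<delta> has_vector_derivative frechet_derivative (F t) (at (x t)) (\<delta> t)) (at t within {0..}))"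

definition characteristic_exponent :: "(real \<Rightarrow> state) \<Rightarrow> ereal" where
  "characteristic_exponent \<delta> = Limsup at_top (\<lambda>t. ereal (ln (norm (\<delta> t)) / t))"

definition lyapunov_exponents :: "(real \<Rightarrow> state \<Rightarrow> state) \<Rightarrow> (real \<Rightarrow> state) \<Rightarrow> ereal set" where
  "lyapunov_exponents F x =
     {characteristic_exponent \<delta> | \<delta>. variational_solution F x \<delta> \<and> \<delta> 0 \<noteq> 0}"

text \<open>
  The multiplicity of an exponent is the jump of the dimension of the Lyapunov filtration. The zero
  solution has exponent \<open>-\<infinity>\<close> by convention; it is listed separately since \<open>ln 0 = 0\<close> here.
\<close>

definition lyapunov_multiplicity ::
    "(real \<Rightarrow> state \<Rightarrow> state) \<Rightarrow> (real \<Rightarrow> state) \<Rightarrow> ereal \<Rightarrow> nat" where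
  "lyapunov_multiplicity F x c =
     dim {\<delta> 0 | \<delta>. variational_solution F x \<delta> \<and> (\<delta> 0 = 0 \<or> characteristic_exponent \<delta> \<le> c)}
     - dim {\<delta> 0 | \<delta>. variational_solution F x \<delta> \<and> (\<delta> 0 = 0 \<or> characteristic_exponent \<delta> < c)}"

end

(* The invariant error of any observer solution solves an autonomous equation, and conversely every
   solution of that equation is the error of an observer solution along any given trajectory; no
   regularity of the inputs is needed, since the trajectory itself moves the frame.  The gains make the
   error field, linearized at (1, 0), a cascade of the longitudinal, lateral, vertical and heading
   systems, so a weighted sum of quadratic Lyapunov functions for these systems gives exponential
   convergence.  Since the change between body frame and Earth frame is isometric, it also turns the
   variational equation along a trajectory into the constant linear one of the error field, which
   fixes the Lyapunov exponents and their multiplicities. *)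

theory Submission
  imports Defs
begin

section \<open>Autonomous differential equations\<close>

text \<open>The observer field depends on time through arbitrary inputs, so existence and uniqueness
  are settled for the error equation alone and carried over to the observer by the frame change;
  \<open>\<epsilon>\<close>, \<open>C\<close> and \<open>\<mu>\<close> then depend only on the
  gains, \<open>A\<close> and \<open>B\<close>, and are the same for every trajectory. Two features
  of the error field obstruct a plain linearization argument. It contains the inverse of a
  quaternion, so it is Lipschitz only away from 0. And the unit sphere is not a linear space: in the
  seven ambient dimensions the real direction of the quaternion is neutral for the linearization, so
  no strict quadratic Lyapunov function exists until a damping term is added. The stability
  hypotheses speak about the behaviour of solutions; they are first converted into signs of
  coefficients, from which the quadratic forms can be written down explicitly. The heading equation
  is driven by the first two angular errors, and the weight on the planar forms is there to absorb
  this coupling.\<close>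

lemma exp_growth_bound:
  fixes u u' :: "real \<Rightarrow> real"
  assumes der: "\<And>t. 0 \<le> t \<Longrightarrow> t \<le> T \<Longrightarrow> (u has_real_derivative u' t) (at t within {0..})"
    and le: "\<And>t. 0 \<le> t \<Longrightarrow> t \<le> T \<Longrightarrow> u' t \<le> k * u t"
    and t: "0 \<le> t" "t \<le> T"
  shows "u t \<le> exp (k * t) * u 0"
proof -
  define w where "w s = exp (- k * s) * u s" for s
  have w': "(w has_real_derivative exp (- k * s) * (u' s - k * u s)) (at s within {0..})"
    if "0 \<le> s" "s \<le> T" for s
    unfolding w_def by (auto intro!: derivative_eq_intros der that simp: algebra_simps)
  have "w t \<le> w 0"
  proof (rule DERIV_nonpos_imp_decreasing_open[OF t(1)])
    fix s assume s: "0 < s" "s < t"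
    have "at s within {0..} = at s"
      using s by (intro at_within_interior) auto
    then have "(w has_real_derivative exp (- k * s) * (u' s - k * u s)) (at s)"
      using w'[of s] s t by simp
    moreover have "exp (- k * s) * (u' s - k * u s) \<le> 0"
      using le[of s] s t by (intro mult_nonneg_nonpos) auto
    ultimately show "\<exists>y. DERIV w s :> y \<and> y \<le> 0"
      by blast
  next
    show "continuous_on {0..t} w"
      unfolding continuous_on_eq_continuous_within
    proof
      fix s assume "s \<in> {0..t}"
      then have "(w has_real_derivative exp (- k * s) * (u' s - k * u s)) (at s within {0..t})"
        using w'[of s] t by (auto intro: DERIV_subset)
      then show "continuous (at s within {0..t}) w"
        by (rule DERIV_continuous)
    qed
  qed
  then have "exp (k * t) * w t \<le> exp (k * t) * w 0"
    by simp
  then show ?thesis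
    by (simp add: w_def mult.assoc[symmetric] exp_add[symmetric])
qed

lemma exp_weighted_integral_bound:
  fixes g :: "real \<Rightarrow> 'a::banach"
  assumes cont: "continuous_on UNIV g"
    and bd: "\<And>s. s \<ge> 0 \<Longrightarrow> norm (g s) \<le> c * exp (k * s)"
    and k: "k > 0" and t: "t \<ge> 0"
  shows "norm (exp (- k * t) *\<^sub>R integral {0..t} g) \<le> c / k"
proof -
  have c: "c \<ge> 0"
    using order_trans[OF norm_ge_zero bd[of 0]] by simp
  have "((\<lambda>s. c * exp (k * s)) has_integral (c * exp (k * t) / k - c * exp (k * 0) / k)) {0..t}"
    using t k by (intro fundamental_theorem_of_calculus)
      (auto intro!: derivative_eq_intros simp: has_real_derivative_iff_has_vector_derivative[symmetric])
  moreover have "g integrable_on {0..t}"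
    using cont by (intro integrable_continuous_real) (auto intro: continuous_on_subset)
  ultimately have "norm (integral {0..t} g) \<le> c * exp (k * t) / k - c * exp (k * 0) / k"
    using bd by (intro integral_norm_bound_integral[THEN order_trans]) (auto intro!: bd simp: has_integral_integrable_integral)
  also have "\<dots> \<le> c * exp (k * t) / k"
    using c k by simp
  finally have "exp (- k * t) * norm (integral {0..t} g) \<le> exp (- k * t) * (c * exp (k * t) / k)"
    by (intro mult_left_mono) auto
  also have "\<dots> = c / k"
    by (simp add: exp_minus field_simps)
  finally show ?thesis
    by simp
qed

text \<open>Picard iteration contracts in the sup norm weighted by \<open>exp (- k t)\<close> with \<open>k = 2 (L + 1)\<close>,
  so a single fixed point gives the solution on all of \<open>[0,\<infinity>)\<close>.\<close>

lemma lipschitz_ode_exists: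
  fixes F :: "'a::banach \<Rightarrow> 'a"
  assumes L: "L-lipschitz_on UNIV F"
  obtains x where "x 0 = x0" "ode_solution UNIV (\<lambda>_. F) x"
proof -
  \<comment> \<open>The contraction factor will be \<open>L / k\<close>, at most 1/2; the summand 1
    keeps \<open>k\<close> positive when \<open>L = 0\<close>.\<close>
  define k where "k = 2 * (L + 1)"
  have L0: "L \<ge> 0"
    using L by (rule lipschitz_on_nonneg)
  then have k: "k > 0"
    by (simp add: k_def)
  have contF: "continuous_on S F" for S
    using lipschitz_on_continuous_on[OF L] by (rule continuous_on_subset) auto
  \<comment> \<open>The unknown \<open>y\<close> is the rescaled deviation of the solution from
    \<open>x0\<close>. With the weight moved into the unknown, the weighted norm becomes the plain
    sup norm of bounded continuous functions.\<close>
  define X where "X y s = x0 + exp (k * s) *\<^sub>R y s" for y :: "real \<Rightarrow> 'a" and s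
  \<comment> \<open>\<open>max 0 t\<close> makes the iterate 0 at negative times, so that it is a
    bounded continuous function on the whole line.\<close>
  define \<Phi> where "\<Phi> y t = exp (- k * max 0 t) *\<^sub>R integral {0..max 0 t} (\<lambda>s. F (X y s))" for y t
  have contX: "continuous_on UNIV (\<lambda>s. F (X y s))" if "continuous_on UNIV y" for y
    unfolding X_def by (rule continuous_on_compose2[OF contF]) (auto intro!: continuous_intros that)
  have I': "((\<lambda>t. integral {0..t} (\<lambda>s. F (X y s))) has_vector_derivative F (X y t)) (at t within {0..})"
    if "continuous_on UNIV y" "t \<ge> 0" for y t
  proof -
    have "((\<lambda>t. integral {0..t} (\<lambda>s. F (X y s))) has_vector_derivative F (X y t)) (at t within {0..t+1})"
      using that contX[OF that(1)] by (intro integral_has_vector_derivative) (auto intro: continuous_on_subset)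
    moreover have "at t within {0..t+1} = at t within {0..}"
      by (rule at_within_nhd[of t "{..<t+1}"]) auto
    ultimately show ?thesis by simp
  qed
  have "\<Phi> (apply_bcontfun y) \<in> bcontfun" for y :: "real \<Rightarrow>\<^sub>C 'a"
  proof -
    obtain M where M: "norm (y s) \<le> M" for s
      using bounded_apply_bcontfun[of y] unfolding bounded_iff by auto
    have "norm (F (X y s)) \<le> (norm (F x0) + L * M) * exp (k * s)" if "s \<ge> 0" for s
    proof -
      have "norm (F (X y s)) \<le> norm (F x0) + norm (F (X y s) - F x0)"
        by norm
      also have "norm (F (X y s) - F x0) \<le> L * norm (X y s - x0)"
        using lipschitz_onD[OF L] by (auto simp: dist_norm)
      also have "\<dots> \<le> L * (exp (k * s) * M)"
        using L0 M by (auto simp: X_def intro!: mult_left_mono)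
      also have "norm (F x0) \<le> norm (F x0) * exp (k * s)"
        using that k by (simp add: mult_le_cancel_left1)
      finally show ?thesis by (simp add: algebra_simps)
    qed
    then have "norm (\<Phi> y t) \<le> (norm (F x0) + L * M) / k" for t
      unfolding \<Phi>_def using contX[of y] k by (intro exp_weighted_integral_bound) auto
    then have "bounded (range (\<Phi> y))"
      unfolding bounded_iff by auto
    moreover have "continuous_on UNIV (\<Phi> y)"
    proof -
      have "continuous_on {0..} (\<lambda>t. integral {0..t} (\<lambda>s. F (X y s)))"
        unfolding continuous_on_eq_continuous_within
        using I'[of y] by (auto intro: has_vector_derivative_continuous)
      then have "continuous_on UNIV (\<lambda>t. integral {0..max 0 t} (\<lambda>s. F (X y s)))"
        by (rule continuous_on_compose2) (auto intro!: continuous_intros)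
      then show ?thesis
        unfolding \<Phi>_def by (intro continuous_intros)
    qed
    ultimately show ?thesis by (simp add: bcontfun_def)
  qed
  then have \<Phi>: "apply_bcontfun (Bcontfun (\<Phi> y)) = \<Phi> y" for y :: "real \<Rightarrow>\<^sub>C 'a"
    by (simp add: Bcontfun_inverse)
  have "dist (Bcontfun (\<Phi> y)) (Bcontfun (\<Phi> z)) \<le> (1/2) * dist y z" for y z :: "real \<Rightarrow>\<^sub>C 'a"
  proof (rule dist_bound)
    fix t :: real
    have int: "(\<lambda>s. F (X u s)) integrable_on {0..max 0 t}" for u :: "real \<Rightarrow>\<^sub>C 'a"
      using contX[of u] by (intro integrable_continuous_real) (auto intro: continuous_on_subset)
    have "norm (F (X y s) - F (X z s)) \<le> (L * dist y z) * exp (k * s)" if "s \<ge> 0" for s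
    proof -
      have "norm (F (X y s) - F (X z s)) \<le> L * norm (X y s - X z s)"
        using lipschitz_onD[OF L] by (auto simp: dist_norm)
      also have "X y s - X z s = exp (k * s) *\<^sub>R (y s - z s)"
        by (simp add: X_def algebra_simps)
      also have "L * norm (exp (k * s) *\<^sub>R (y s - z s)) \<le> L * (exp (k * s) * dist y z)"
        using L0 dist_bounded[of y s z] by (auto simp: dist_norm intro!: mult_left_mono)
      finally show ?thesis by (simp add: algebra_simps)
    qed
    then have "norm (exp (- k * max 0 t) *\<^sub>R integral {0..max 0 t} (\<lambda>s. F (X y s) - F (X z s)))
        \<le> (L * dist y z) / k"
      using contX[of y] contX[of z] k
      by (intro exp_weighted_integral_bound) (auto intro!: continuous_intros)
    also have "\<dots> \<le> (1/2) * dist y z"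
      using L0 by (simp add: k_def field_simps)
    finally show "dist (apply_bcontfun (Bcontfun (\<Phi> y)) t) (apply_bcontfun (Bcontfun (\<Phi> z)) t) \<le> (1/2) * dist y z"
      using int[of y] int[of z]
      by (simp add: \<Phi> dist_norm \<Phi>_def[of _ t] integral_diff scaleR_diff_right)
  qed
  then obtain y :: "real \<Rightarrow>\<^sub>C 'a" where y: "Bcontfun (\<Phi> y) = y"
    using banach_fix_type[of "1/2" "\<lambda>y::real \<Rightarrow>\<^sub>C 'a. Bcontfun (\<Phi> y)"] by auto
  have y: "y t = exp (- k * t) *\<^sub>R integral {0..t} (\<lambda>s. F (X y s))" if "t \<ge> 0" for t
  proof -
    have "y t = \<Phi> y t"
      using \<Phi>[of y] unfolding y by (rule fun_cong)
    then show ?thesis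
      using that by (simp add: \<Phi>_def max_def)
  qed
  have X: "X y t = x0 + integral {0..t} (\<lambda>s. F (X y s))" if "t \<ge> 0" for t
    using y[OF that] by (simp add: X_def exp_minus)
  have "(X y has_vector_derivative F (X y t)) (at t within {0..})" if "t \<ge> 0" for t
    by (rule has_vector_derivative_transform[of _ _ _ "\<lambda>t. x0 + integral {0..t} (\<lambda>s. F (X y s))"])
      (auto intro!: derivative_eq_intros I' that simp: X)
  moreover have "X y 0 = x0"
    using X[of 0] by simp
  ultimately show thesis
    by (intro that[of "X y"]) (auto simp: ode_solution_def)
qed

lemma ode_solution_continuous_on:
  assumes "ode_solution S F x"
  shows "continuous_on {0..} x"
  using assms unfolding ode_solution_def continuous_on_eq_continuous_within
  by (auto intro: has_vector_derivative_continuous)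

lemma has_real_derivative_bilinear:
  assumes "bounded_bilinear W"
    and "(x has_vector_derivative x') (at t within S)" "(y has_vector_derivative y') (at t within S)"
  shows "((\<lambda>t. W (x t) (y t)) has_real_derivative W (x t) y' + W x' (y t)) (at t within S)"
  unfolding has_real_derivative_iff_has_vector_derivative
  by (rule bounded_bilinear.has_vector_derivative[OF assms])

text \<open>On \<open>{0..t}\<close> both solutions stay in one ball by compactness, so a single
  Lipschitz constant \<open>L\<close> applies and the squared distance grows at rate at most
  \<open>2 * L\<close> from the value 0.\<close>

lemma ode_solution_unique:
  fixes F :: "'a::real_inner \<Rightarrow> 'a"
  assumes lip: "\<And>R. \<exists>L. L-lipschitz_on (S \<inter> cball 0 R) F"
    and x: "ode_solution S (\<lambda>_. F) x" and y: "ode_solution S (\<lambda>_. F) y"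
    and eq: "x 0 = y 0" and t: "t \<ge> 0"
  shows "x t = y t"
proof -
  have "\<exists>R. \<forall>s\<in>{0..t}. norm (u s) \<le> R" if "ode_solution S (\<lambda>_. F) u" for u
  proof -
    have "compact (u ` {0..t})"
      using ode_solution_continuous_on[OF that]
      by (intro compact_continuous_image) (auto intro: continuous_on_subset)
    then show ?thesis
      by (auto simp: bounded_iff dest: compact_imp_bounded)
  qed
  from this[OF x] this[OF y] obtain R1 R2
    where R: "s \<in> {0..t} \<Longrightarrow> norm (x s) \<le> R1" "s \<in> {0..t} \<Longrightarrow> norm (y s) \<le> R2" for s
    by blast
  obtain L where L: "L-lipschitz_on (S \<inter> cball 0 (max R1 R2)) F"
    using lip by blast
  define d where "d s = (x s - y s) \<bullet> (x s - y s)" for s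
  have "d t \<le> exp ((2 * L) * t) * d 0"
  proof (rule exp_growth_bound[where T = t])
    fix s assume s: "0 \<le> s" "s \<le> t"
    show "(d has_real_derivative (x s - y s) \<bullet> (F (x s) - F (y s)) + (F (x s) - F (y s)) \<bullet> (x s - y s))
        (at s within {0..})"
      unfolding d_def using x y s
      by (intro has_real_derivative_bilinear[OF bounded_bilinear_inner] has_vector_derivative_diff)
        (auto simp: ode_solution_def)
    have "(x s - y s) \<bullet> (F (x s) - F (y s)) \<le> norm (x s - y s) * norm (F (x s) - F (y s))"
      by (rule norm_cauchy_schwarz)
    also have "\<dots> \<le> norm (x s - y s) * (L * norm (x s - y s))"
      using lipschitz_onD[OF L, of "x s" "y s"] R[of s] x y s
      by (intro mult_left_mono) (auto simp: ode_solution_def dist_norm le_max_iff_disj)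
    also have "\<dots> = L * d s"
      by (simp add: d_def dot_square_norm power2_eq_square)
    finally show "(x s - y s) \<bullet> (F (x s) - F (y s)) + (F (x s) - F (y s)) \<bullet> (x s - y s) \<le> (2 * L) * d s"
      by (simp add: inner_commute)
  qed (use t in auto)
  then have "d t \<le> 0"
    by (simp add: d_def eq)
  then have "d t = 0"
    unfolding d_def by (intro order_antisym inner_ge_zero)
  then show ?thesis
    by (simp add: d_def)
qed

section \<open>Lyapunov's indirect method\<close>

text \<open>Compactness of the unit sphere makes positivity uniform: the minimum of the quadratic
  form there serves as \<open>c\<close>, and homogeneity extends the bound to all vectors.\<close>

lemma bilinear_form_pos_bound:
  fixes W :: "'a::euclidean_space \<Rightarrow> 'a \<Rightarrow> real"
  assumes W: "bounded_bilinear W" and pos: "\<And>x. x \<noteq> 0 \<Longrightarrow> W x x > 0"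
  obtains c where "c > 0" "\<And>x. c * (norm x)\<^sup>2 \<le> W x x"
proof -
  interpret bounded_bilinear W by (rule W)
  have "continuous_on (sphere 0 1) (\<lambda>x. W x x)"
    by (rule continuous_on[OF continuous_on_id continuous_on_id])
  then have "\<exists>u\<in>sphere 0 1. \<forall>y\<in>sphere 0 1. W u u \<le> W y y"
    by (intro continuous_attains_inf) simp_all
  then obtain u where u: "u \<in> sphere 0 1" "\<And>y. y \<in> sphere 0 1 \<Longrightarrow> W u u \<le> W y y"
    by auto
  have "W u u * (norm x)\<^sup>2 \<le> W x x" for x
  proof (cases "x = 0")
    case True
    then show ?thesis by (simp add: zero_left)
  next
    case False
    then have "W u u \<le> W (sgn x) (sgn x)"
      by (intro u) (simp add: norm_sgn)
    also have "\<dots> = W x x / (norm x)\<^sup>2"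
      by (simp add: sgn_div_norm scaleR_left scaleR_right power2_eq_square field_simps)
    finally show ?thesis
      using False by (simp add: field_simps)
  qed
  moreover have "W u u > 0"
    using u(1) by (intro pos) auto
  ultimately show thesis by (rule that[rotated])
qed

lemma closest_point_cball_0:
  fixes x :: "'a::euclidean_space"
  assumes r: "r > 0" "norm x \<ge> r"
  shows "closest_point (cball 0 r) x = (r / norm x) *\<^sub>R x"
proof (rule closest_point_unique[symmetric])
  show "\<forall>z\<in>cball 0 r. dist x ((r / norm x) *\<^sub>R x) \<le> dist x z"
  proof
    fix z :: 'a assume "z \<in> cball 0 r"
    then have "norm x - r \<le> norm x - norm z" by simp
    also have "\<dots> \<le> dist x z"
      by (simp add: dist_norm norm_triangle_ineq2)
    finally have *: "norm x - r \<le> dist x z" .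
    have "x - (r / norm x) *\<^sub>R x = (1 - r / norm x) *\<^sub>R x"
      by (simp add: algebra_simps)
    then have "dist x ((r / norm x) *\<^sub>R x) = \<bar>1 - r / norm x\<bar> * norm x"
      by (simp add: dist_norm)
    also have "\<dots> = norm x - r"
      using r by (auto simp: field_simps abs_if)
    finally show "dist x ((r / norm x) *\<^sub>R x) \<le> dist x z"
      using * by simp
  qed
qed (use r in auto)

text \<open>Composing the field with the projection onto a ball makes it globally Lipschitz, and as the
  projection rescales by a factor in \<open>(0, 1]\<close>, the Lyapunov function stays nonincreasing
  everywhere, so that solutions starting near \<open>0\<close> never notice the modification.\<close>

lemma lyapunov_exponential_stability:
  fixes F L :: "'a::euclidean_space \<Rightarrow> 'a" and W :: "'a \<Rightarrow> 'a \<Rightarrow> real"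
  assumes F': "(F has_derivative L) (at 0)" and F0: "F 0 = 0"
    and W: "bounded_bilinear W" and sym: "\<And>x y. W x y = W y x"
    and pos: "\<And>x. x \<noteq> 0 \<Longrightarrow> W x x > 0" and neg: "\<And>x. x \<noteq> 0 \<Longrightarrow> W x (L x) < 0"
    and R: "R > 0" and lip: "K-lipschitz_on (cball 0 R) F"
  obtains \<epsilon> C \<mu> where "\<epsilon> > 0" "C > 0" "\<mu> > 0"
    "\<And>z. norm z < \<epsilon> \<Longrightarrow> \<exists>x. x 0 = z \<and> ode_solution (cball 0 R) (\<lambda>_. F) x \<and>
       (\<forall>t\<ge>0. norm (x t) \<le> C * exp (- \<mu> * t) * norm z)"
proof -
  interpret bounded_bilinear W by (rule W)
  have L: "bounded_linear L"
    using F' by (rule has_derivative_bounded_linear)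
  obtain \<alpha> where \<alpha>: "\<alpha> > 0" "\<And>x. \<alpha> * (norm x)\<^sup>2 \<le> W x x"
    using bilinear_form_pos_bound[OF W pos] by blast
  obtain \<beta> where \<beta>: "\<beta> > 0" "\<And>x y. norm (W x y) \<le> norm x * norm y * \<beta>"
    using pos_bounded by blast
  obtain \<gamma> where \<gamma>: "\<gamma> > 0" "\<And>x. \<gamma> * (norm x)\<^sup>2 \<le> W x (- L x)"
    using bilinear_form_pos_bound[OF comp[OF bounded_linear_ident bounded_linear_minus[OF L]]] neg
    by (auto simp: minus_right)
  \<comment> \<open>The tolerance is chosen so that the linearization error, after the bound
    \<open>\<beta>\<close> on \<open>W\<close>, costs exactly half of the decay
    \<open>\<gamma>\<close> of the linear part.\<close>
  obtain d where d: "d > 0" "\<And>y. norm y < d \<Longrightarrow> norm (F y - L y) \<le> \<gamma> / (2 * \<beta>) * norm y"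
  proof -
    have "\<gamma> / (2 * \<beta>) > 0" using \<gamma> \<beta> by simp
    with F' obtain d where "d > 0"
      "\<forall>y. norm (y - 0) < d \<longrightarrow> norm (F y - F 0 - L (y - 0)) \<le> \<gamma> / (2 * \<beta>) * norm (y - 0)"
      unfolding has_derivative_at_alt by blast
    then show thesis using F0 by (intro that[of d]) auto
  qed
  define r where "r = min R (d / 2)"
  have r: "r > 0" "r \<le> R" "r < d"
    using R d(1) by (auto simp: r_def min_def)
  have WF: "W x (F x) \<le> - (\<gamma> / 2) * (norm x)\<^sup>2" if "norm x \<le> r" for x
  proof -
    have "W x (F x) = W x (L x) + W x (F x - L x)"
      by (simp add: diff_right)
    also have "W x (F x - L x) \<le> norm x * norm (F x - L x) * \<beta>"
      using \<beta>(2)[of x "F x - L x"] by simp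
    also have "\<dots> \<le> norm x * (\<gamma> / (2 * \<beta>) * norm x) * \<beta>"
      using d(2)[of x] that r \<beta> by (intro mult_right_mono mult_left_mono) auto
    also have "\<dots> = (\<gamma> / 2) * (norm x)\<^sup>2"
      using \<beta> by (simp add: power2_eq_square)
    finally show ?thesis
      using \<gamma>(2)[of x] by (simp add: minus_right)
  qed
  define proj where "proj = closest_point (cball 0 r :: 'a set)"
  define G where "G = F \<circ> proj"
  have projr: "proj x \<in> cball 0 r" for x
    unfolding proj_def using r by (intro closest_point_in_set) auto
  have projid: "proj x = x" if "norm x \<le> r" for x
    using that by (simp add: proj_def closest_point_self)
  have "1-lipschitz_on UNIV proj"
    unfolding proj_def using r by (intro lipschitz_onI) (auto intro!: closest_point_lipschitz)
  moreover have "K-lipschitz_on (range proj) F"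
    using projr order_trans[OF _ r(2)] by (intro lipschitz_on_subset[OF lip]) (simp add: image_subset_iff)
  ultimately have lipG: "(K * 1)-lipschitz_on UNIV G"
    unfolding G_def by (intro lipschitz_on_compose)
  have WG: "W x (G x) \<le> 0" for x
  proof -
    obtain s where s: "s \<ge> 0" "x = s *\<^sub>R proj x"
    proof (cases "norm x \<le> r")
      case True
      then show ?thesis by (intro that[of 1]) (auto simp: projid)
    next
      case False
      then show ?thesis
        using r by (intro that[of "norm x / r"]) (auto simp: proj_def closest_point_cball_0)
    qed
    have "W (proj x) (F (proj x)) \<le> - (\<gamma> / 2) * (norm (proj x))\<^sup>2"
      using projr[of x] by (intro WF) simp
    also have "\<dots> \<le> 0" using \<gamma>(1) by simp
    finally have "s * W (proj x) (F (proj x)) \<le> 0"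
      using s(1) by (simp add: mult_nonneg_nonpos)
    also have "s * W (proj x) (F (proj x)) = W (s *\<^sub>R proj x) (G x)"
      by (simp add: scaleR_left G_def)
    finally show ?thesis using s(2) by simp
  qed
  \<comment> \<open>\<open>W\<close> lies between \<open>\<alpha>\<close> and \<open>\<beta>\<close>
    times the squared norm; passing from the norm to \<open>W\<close> and back costs this
    factor.\<close>
  define C where "C = sqrt (\<beta> / \<alpha>)"
  have C: "C > 0" "C\<^sup>2 = \<beta> / \<alpha>"
    using \<alpha>(1) \<beta>(1) by (simp_all add: C_def)
  have WC: "norm x \<le> C * (exp (- \<kappa>) * norm z)" if "W x x \<le> exp (- 2 * \<kappa>) * W z z" for x z \<kappa>
  proof (rule power2_le_imp_le)
    have "\<alpha> * (norm x)\<^sup>2 \<le> W x x" by (rule \<alpha>)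
    also note that
    also have "W z z \<le> norm z * norm z * \<beta>"
      using \<beta>(2)[of z z] by simp
    finally have "\<alpha> * (norm x)\<^sup>2 \<le> exp (- 2 * \<kappa>) * (norm z * norm z * \<beta>)"
      by simp
    then have "(norm x)\<^sup>2 \<le> (\<beta> / \<alpha>) * (exp (- 2 * \<kappa>) * (norm z)\<^sup>2)"
      using \<alpha>(1) by (simp add: field_simps power2_eq_square)
    also have "\<dots> = (C * (exp (- \<kappa>) * norm z))\<^sup>2"
      unfolding power_mult_distrib C(2) exp_double[symmetric] by simp
    finally show "(norm x)\<^sup>2 \<le> (C * (exp (- \<kappa>) * norm z))\<^sup>2" .
  qed (use C in auto)
  \<comment> \<open>\<open>W\<close> decays at rate \<open>\<gamma> / \<beta>\<close>, and the norm,
    being comparable to the square root of \<open>W\<close>, at half that rate.\<close>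
  define \<mu> where "\<mu> = \<gamma> / (2 * \<beta>)"
  have \<mu>: "\<mu> > 0" using \<gamma>(1) \<beta>(1) by (simp add: \<mu>_def)
  show thesis
  proof (rule that[of "r / C" C \<mu>])
    fix z :: 'a assume z: "norm z < r / C"
    obtain x where x: "x 0 = z" "ode_solution UNIV (\<lambda>_. G) x"
      using lipschitz_ode_exists[OF lipG] by blast
    have W': "((\<lambda>t. W (x t) (x t)) has_real_derivative 2 * W (x t) (G (x t))) (at t within {0..})"
      if "t \<ge> 0" for t
      using has_real_derivative_bilinear[OF W, of x "G (x t)" t "{0..}" x "G (x t)"] x(2) that
      by (simp add: ode_solution_def sym[of "G _"])
    \<comment> \<open>Two passes are made. The crude bound, with rate 0, confines the solution to
      the ball where \<open>G\<close> equals \<open>F\<close>; only there is the strict decay of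
      \<open>W\<close> available for the second pass.\<close>
    have xr: "norm (x t) \<le> r" if "t \<ge> 0" for t
    proof -
      have "W (x t) (x t) \<le> exp (0 * t) * W (x 0) (x 0)"
        using that WG by (intro exp_growth_bound[where T = t, OF W']) auto
      then have "norm (x t) \<le> C * (exp (- 0) * norm z)"
        using x(1) by (intro WC) auto
      also have "\<dots> \<le> r"
        using z C by (simp add: field_simps)
      finally show ?thesis .
    qed
    then have G: "G (x t) = F (x t)" if "t \<ge> 0" for t
      using that by (simp add: G_def projid)
    have "norm (x t) \<le> C * exp (- \<mu> * t) * norm z" if t: "t \<ge> 0" for t
    proof -
      have "W (x t) (x t) \<le> exp (- (2 * \<mu>) * t) * W (x 0) (x 0)"
      proof (rule exp_growth_bound[where T = t, OF W'])
        fix s :: real assume s: "s \<ge> 0"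
        have "2 * W (x s) (G (x s)) \<le> - \<gamma> * (norm (x s))\<^sup>2"
          using WF[OF xr[OF s]] G[OF s] by simp
        also have "(- \<gamma>) * (norm (x s))\<^sup>2 \<le> - (\<gamma> / \<beta>) * W (x s) (x s)"
          using \<beta>(2)[of "x s" "x s"] \<beta>(1) \<gamma>(1)
          by (simp add: field_simps power2_eq_square)
        also have "\<gamma> / \<beta> = 2 * \<mu>"
          by (simp add: \<mu>_def)
        finally show "2 * W (x s) (G (x s)) \<le> - (2 * \<mu>) * W (x s) (x s)" .
      qed (use t in auto)
      then have "norm (x t) \<le> C * (exp (- (\<mu> * t)) * norm z)"
        using x(1) by (intro WC) (auto simp: mult.assoc)
      then show ?thesis by simp
    qed
    moreover have "ode_solution (cball 0 R) (\<lambda>_. F) x"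
      using x(2) xr r G unfolding ode_solution_def by (force intro: order_trans)
    ultimately show "\<exists>x. x 0 = z \<and> ode_solution (cball 0 R) (\<lambda>_. F) x \<and>
        (\<forall>t\<ge>0. norm (x t) \<le> C * exp (- \<mu> * t) * norm z)"
      using x(1) by blast
  qed (use r C \<mu> in auto)
qed

section \<open>Stable linear systems in low dimension\<close>

text \<open>Attraction is assumed only near 0, but a linear field allows any solution to be scaled
  into that neighbourhood and back.\<close>

lemma linear_stable_tendsto:
  assumes f: "linear f" and stable: "asymptotically_stable f"
    and x: "ode_solution UNIV (\<lambda>_. f) x"
  shows "(x \<longlongrightarrow> 0) at_top"
proof -
  obtain \<delta> where \<delta>: "\<delta> > 0"
    "\<And>y. ode_solution UNIV (\<lambda>_. f) y \<Longrightarrow> norm (y 0) < \<delta> \<Longrightarrow> (y \<longlongrightarrow> 0) at_top"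
    using stable unfolding asymptotically_stable_def by blast
  define c where "c = \<delta> / (norm (x 0) + 1)"
  have c: "c > 0"
    using \<delta>(1) by (auto simp: c_def intro!: divide_pos_pos add_nonneg_pos)
  have "norm (x 0) + 1 > 0"
    by (intro add_nonneg_pos) auto
  then have "c * norm (x 0) < \<delta>"
    using \<delta>(1) by (simp add: c_def field_simps)
  moreover have "ode_solution UNIV (\<lambda>_. f) (\<lambda>t. c *\<^sub>R x t)"
    using x unfolding ode_solution_def
    by (auto simp: linear_scale[OF f] intro!: derivative_eq_intros)
  ultimately have "((\<lambda>t. c *\<^sub>R x t) \<longlongrightarrow> 0) at_top"
    using c by (intro \<delta>(2)) auto
  then have "((\<lambda>t. (1 / c) *\<^sub>R (c *\<^sub>R x t)) \<longlongrightarrow> (1 / c) *\<^sub>R 0) at_top"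
    by (intro tendsto_intros)
  then show ?thesis
    using c by simp
qed

text \<open>For \<open>s \<ge> 0\<close> the solution through the eigenvector never becomes shorter
  than \<open>u\<close>, contradicting attraction.\<close>

lemma linear_stable_eigenvalue_neg:
  assumes f: "linear f" and stable: "asymptotically_stable f"
    and u: "f u = s *\<^sub>R u" "u \<noteq> 0"
  shows "s < 0"
proof (rule ccontr)
  assume "\<not> s < 0"
  have "((\<lambda>t. exp (s * t) *\<^sub>R u) \<longlongrightarrow> 0) at_top"
    by (rule linear_stable_tendsto[OF f stable])
      (auto simp: ode_solution_def linear_scale[OF f] u has_real_derivative_iff_has_vector_derivative[symmetric]
        intro!: derivative_eq_intros)
  then have "((\<lambda>t. norm (exp (s * t) *\<^sub>R u)) \<longlongrightarrow> 0) at_top"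
    by (rule tendsto_norm_zero)
  moreover have "\<forall>\<^sub>F t in at_top. norm u \<le> norm (exp (s * t) *\<^sub>R u)"
    using eventually_ge_at_top[of 0]
  proof eventually_elim
    case (elim t)
    then show ?case
      using \<open>\<not> s < 0\<close> by (simp add: mult_le_cancel_right1)
  qed
  ultimately have "norm u \<le> 0"
    by (intro tendsto_lowerbound) auto
  with u(2) show False by simp
qed

text \<open>A common shape for the longitudinal and lateral systems: a planar matrix with trace
  \<open>- n\<close> and determinant \<open>b * c\<close>. Stability will force \<open>n\<close> and
  \<open>b * c\<close> to be positive.\<close>

definition planar_field :: "real \<Rightarrow> real \<Rightarrow> real \<Rightarrow> real^2 \<Rightarrow> real^2" where
  "planar_field b c n z = vector [b * z$2, - c * z$1 - n * z$2]"

lemma linear_planar_field: "linear (planar_field b c n)"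
  by (intro linearI) (simp_all add: planar_field_def vec_eq_iff forall_2 algebra_simps)

text \<open>The Wronskian of two solutions decays like \<open>exp (- n t)\<close>.\<close>

lemma planar_stable_trace:
  assumes stable: "asymptotically_stable (planar_field b c n)"
  shows "n > 0"
proof (rule ccontr)
  assume "\<not> n > 0"
  obtain L where "L-lipschitz_on UNIV (planar_field b c n)"
    using linear_planar_field linear_conv_bounded_linear bounded_linear.lipschitz_boundE by blast
  note ex = lipschitz_ode_exists[OF this]
  obtain x where x: "x 0 = vector [1, 0]" "ode_solution UNIV (\<lambda>_. planar_field b c n) x"
    using ex by blast
  obtain y where y: "y 0 = vector [0, 1]" "ode_solution UNIV (\<lambda>_. planar_field b c n) y"
    using ex by blast
  have comp: "((\<lambda>t. u t $ 1) has_real_derivative b * u t $ 2) (at t within {0..})"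
       "((\<lambda>t. u t $ 2) has_real_derivative - c * u t $ 1 - n * u t $ 2) (at t within {0..})"
    if "ode_solution UNIV (\<lambda>_. planar_field b c n) u" "t \<ge> 0" for u t
  proof -
    have "(u has_vector_derivative planar_field b c n (u t)) (at t within {0..})"
      using that by (simp add: ode_solution_def)
    from bounded_linear.has_vector_derivative[OF bounded_linear_vec_nth this, of 1]
      bounded_linear.has_vector_derivative[OF bounded_linear_vec_nth this, of 2]
    show "((\<lambda>t. u t $ 1) has_real_derivative b * u t $ 2) (at t within {0..})"
       "((\<lambda>t. u t $ 2) has_real_derivative - c * u t $ 1 - n * u t $ 2) (at t within {0..})"
      by (simp_all add: has_real_derivative_iff_has_vector_derivative planar_field_def)
  qed
  \<comment> \<open>The Wronskian treats real and complex eigenvalues alike: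
    \<open>w' = - n * w\<close> and \<open>w 0 = 1\<close>, so for \<open>n \<le> 0\<close> it stays
    at least 1 although both solutions tend to 0.\<close>
  define w where "w t = x t $ 1 * y t $ 2 - x t $ 2 * y t $ 1" for t
  \<comment> \<open>\<open>exp_growth_bound\<close> gives upper bounds only; applied to
    \<open>- w\<close> it bounds \<open>w\<close> from below.\<close>
  have "- w t \<le> exp (- n * t) * - w 0" if "t \<ge> 0" for t
  proof (rule exp_growth_bound[where T = t and u' = "\<lambda>t. - n * - w t"])
    fix s :: real assume s: "s \<ge> 0"
    show "((\<lambda>t. - w t) has_real_derivative - n * - w s) (at s within {0..})"
      unfolding w_def
      by (auto intro!: derivative_eq_intros comp[OF x(2) s] comp[OF y(2) s] simp: algebra_simps)
  qed (use that in auto)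
  then have w: "exp (- n * t) \<le> w t" if "t \<ge> 0" for t
    using that by (fastforce simp: w_def[of 0] x(1) y(1))
  have ev: "\<forall>\<^sub>F t in at_top. 1 \<le> w t"
    using eventually_ge_at_top[of 0]
  proof eventually_elim
    case (elim t)
    have "1 \<le> exp (- n * t)"
      using elim \<open>\<not> n > 0\<close> by (simp add: mult_nonpos_nonneg)
    from order_trans[OF this w[OF elim]] show ?case .
  qed
  have "(x \<longlongrightarrow> 0) at_top" "(y \<longlongrightarrow> 0) at_top"
    using linear_stable_tendsto[OF linear_planar_field stable] x y by blast+
  then have "(w \<longlongrightarrow> (0::real^2) $ 1 * (0::real^2) $ 2 - (0::real^2) $ 2 * (0::real^2) $ 1) at_top"
    unfolding w_def by (intro tendsto_intros)
  with ev have "1 \<le> (0::real)"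
    by (intro tendsto_lowerbound[of w 0 at_top]) auto
  then show False by simp
qed

text \<open>If \<open>b * c \<le> 0\<close>, the characteristic polynomial
  \<open>s * s + n * s + b * c\<close> has a nonnegative real root, here the larger root
  \<open>s\<close>, and its eigenvector contradicts stability.\<close>

lemma planar_stable_det:
  assumes stable: "asymptotically_stable (planar_field b c n)"
  shows "b * c > 0"
proof (rule ccontr)
  assume neg: "\<not> b * c > 0"
  have n: "n > 0"
    using stable by (rule planar_stable_trace)
  define s where "s = (- n + sqrt (n\<^sup>2 - 4 * (b * c))) / 2"
  have "sqrt (n\<^sup>2) \<le> sqrt (n\<^sup>2 - 4 * (b * c))"
    using neg by (subst real_sqrt_le_iff) simp
  then have s0: "s \<ge> 0"
    using n by (simp add: s_def)
  have "(2 * s + n)\<^sup>2 = n\<^sup>2 - 4 * (b * c)"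
  proof -
    have "2 * s + n = sqrt (n\<^sup>2 - 4 * (b * c))"
      by (simp add: s_def field_simps)
    moreover have "n\<^sup>2 - 4 * (b * c) \<ge> 0"
      using neg zero_le_power2[of n] by linarith
    ultimately show ?thesis by simp
  qed
  then have s2: "s * s = - n * s - b * c"
    by (simp add: power2_eq_square algebra_simps)
  have "\<exists>u \<sigma>. \<sigma> \<ge> 0 \<and> u \<noteq> 0 \<and> planar_field b c n u = \<sigma> *\<^sub>R u"
  \<comment> \<open>For \<open>b = 0\<close> the candidate \<open>vector [b, s]\<close> may vanish;
    the matrix is then singular and \<open>vector [n, - c]\<close> spans its kernel.\<close>
  proof (cases "b = 0")
    case True
    then show ?thesis
      using n by (intro exI[of _ "vector [n, - c]"] exI[of _ 0])
        (simp add: planar_field_def vec_eq_iff forall_2)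
  next
    case False
    then show ?thesis
      using s0 s2 by (intro exI[of _ "vector [b, s]"] exI[of _ s])
        (simp add: planar_field_def vec_eq_iff forall_2 algebra_simps)
  qed
  then show False
    using linear_stable_eigenvalue_neg[OF linear_planar_field stable] by force
qed

text \<open>The form solves the Lyapunov equation whose right-hand side is minus the identity.\<close>

lemma planar_lyapunov_form:
  fixes b c n :: real
  assumes n: "n > 0" and bc: "b * c > 0"
  obtains p r s where
    "\<And>y z. (y, z) \<noteq> (0, 0) \<Longrightarrow> p * y\<^sup>2 + 2 * r * y * z + s * z\<^sup>2 > 0"
    "\<And>y z. p * y * (b * z) + r * (y * (- c * y - n * z) + z * (b * z)) + s * z * (- c * y - n * z)
       = - (y\<^sup>2 + z\<^sup>2) / 2"
proof -
  have b: "b \<noteq> 0" and c: "c \<noteq> 0" using bc by auto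
  have cb: "c / b > 0" "b / c > 0"
    using bc by (auto simp: zero_less_mult_iff zero_less_divide_iff)
  \<comment> \<open>Comparing coefficients of the Lyapunov identity gives \<open>r * c = 1/2\<close>
    from the squares of \<open>y\<close>, \<open>s * n = 1/2 + r * b\<close> from those of
    \<open>z\<close>, and \<open>p * b = r * n + s * c\<close> from the mixed term. The identity is
    for half the derivative of the form, hence the factor 1/2 on its right.\<close>
  define r where "r = 1 / (2 * c)"
  define s where "s = (1 + b / c) / (2 * n)"
  define p where "p = n / (2 * (b * c)) + (1 + c / b) / (2 * n)"
  have s: "s > 0" using cb n by (simp add: s_def add_pos_pos)
  \<comment> \<open>Positivity of the form needs \<open>s > 0\<close> and a positive determinant.
    Expanding \<open>p * s\<close> produces one product equal to the square of \<open>r\<close>;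
    what remains is a sum of positive terms.\<close>
  have "p * s - r\<^sup>2 = (n / (2 * (b * c)) + (1 + c / b) / (2 * n)) * (1 / (2 * n))
      + (1 + c / b) / (2 * n) * ((b / c) / (2 * n))"
    using b c n by (simp add: p_def s_def r_def field_simps power2_eq_square)
  also have "\<dots> > 0"
  proof -
    have "n / (2 * (b * c)) > 0" "1 + c / b > 0" "1 / (2 * n) > 0" "(b / c) / (2 * n) > 0"
      using cb n bc by (simp_all only: add_pos_pos divide_pos_pos mult_pos_pos zero_less_one zero_less_numeral)
    then show ?thesis
      using n cb by (intro add_pos_pos mult_pos_pos divide_pos_pos[of "1 + c / b"]) simp_all
  qed
  finally have D: "p * s - r\<^sup>2 > 0" .
  have "p * y\<^sup>2 + 2 * r * y * z + s * z\<^sup>2 > 0" if "(y, z) \<noteq> (0, 0)" for y z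
  proof -
    have "s * (p * y\<^sup>2 + 2 * r * y * z + s * z\<^sup>2) = (p * s - r\<^sup>2) * y\<^sup>2 + (s * z + r * y)\<^sup>2"
      by (simp add: power2_eq_square algebra_simps)
    also have "\<dots> > 0"
      using that D s by (cases "y = 0") (auto intro: add_pos_nonneg)
    finally show ?thesis using s by (simp add: zero_less_mult_iff)
  qed
  moreover have "p * y * (b * z) + r * (y * (- c * y - n * z) + z * (b * z)) + s * z * (- c * y - n * z)
       = - (y\<^sup>2 + z\<^sup>2) / 2" for y z
  proof -
    have "r * c = 1 / 2" "s * n = 1/2 + r * b" "p * b = r * n + s * c"
      using b c n by (simp_all add: p_def s_def r_def field_simps)
    then show ?thesis by algebra
  qed
  ultimately show thesis by (rule that)
qed

section \<open>Quaternions and rotating frames\<close>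

lemma imq_linear: "linear imq"
  by (intro linearI) (simp_all add: imq_def quat_eq_iff)

lemma vecq_linear: "linear vecq"
  by (intro linearI) (simp_all add: vecq_def vec_eq_iff forall_3)

lemma bounded_linear_imq: "bounded_linear imq"
  using imq_linear by (simp add: linear_conv_bounded_linear)

lemma bounded_linear_vecq: "bounded_linear vecq"
  using vecq_linear by (simp add: linear_conv_bounded_linear)

lemmas imq_simps = linear_add[OF imq_linear] linear_diff[OF imq_linear] linear_neg[OF imq_linear]
  linear_0[OF imq_linear] linear_scale[OF imq_linear]

lemmas vecq_simps = linear_add[OF vecq_linear] linear_diff[OF vecq_linear] linear_neg[OF vecq_linear]
  linear_0[OF vecq_linear] linear_scale[OF vecq_linear]

lemmas imq_has_vector_derivative [derivative_intros] =
  bounded_linear.has_vector_derivative[OF bounded_linear_imq]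

lemmas vecq_has_vector_derivative [derivative_intros] =
  bounded_linear.has_vector_derivative[OF bounded_linear_vecq]

lemmas imq_has_derivative [derivative_intros] =
  bounded_linear.has_derivative[OF bounded_linear_imq]

lemmas vecq_has_derivative [derivative_intros] =
  bounded_linear.has_derivative[OF bounded_linear_vecq]

lemma norm_imq: "norm (imq p) = norm p"
  by (simp add: norm_quat_def imq_def norm_vec_def L2_set_def sum_3)

lemma inverse_has_vector_derivative:
  fixes q :: "real \<Rightarrow> 'a::real_normed_div_algebra"
  assumes q: "(q has_vector_derivative q') (at t within S)" and "q t \<noteq> 0"
  shows "((\<lambda>t. inverse (q t)) has_vector_derivative - (inverse (q t) * q' * inverse (q t))) (at t within S)"
  using Deriv.has_derivative_inverse[OF assms(2) q[unfolded has_vector_derivative_def]]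
  by (simp add: has_vector_derivative_def)

lemma inverse_mult_cancel:
  fixes q z :: "'a::division_ring"
  assumes "q \<noteq> 0"
  shows "inverse q * (q * z) = z" "q * (inverse q * z) = z"
  using assms by (simp_all flip: mult.assoc)

text \<open>Both frame changes are linear in \<open>h\<close>. As \<open>inv_error x z\<close> is
  \<open>to_earth (fst x)\<close> applied to \<open>z - (0, snd x)\<close>, the error is affine in
  the estimate for fixed \<open>x\<close>, and the same maps serve the variational equation.\<close>

definition to_earth :: "quat \<Rightarrow> state \<Rightarrow> state" where
  "to_earth q h = (fst h * inverse q, vecq (q * imq (snd h) * inverse q))"

definition to_body :: "quat \<Rightarrow> state \<Rightarrow> state" where
  "to_body q h = (fst h * q, vecq (inverse q * imq (snd h) * q))"

text \<open>The share of the angular velocity in the dynamics. It is linear in the state, which is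
  why the moving frame can cancel it exactly.\<close>

definition frame_rotation :: "real^3 \<Rightarrow> state \<Rightarrow> state" where
  "frame_rotation w h = ((1/2) *\<^sub>R (fst h * imq w), cross3 (snd h) w)"

lemma linear_to_earth: "linear (to_earth q)"
  by (intro linearI) (simp_all add: to_earth_def imq_simps vecq_simps algebra_simps)

lemma linear_to_body: "linear (to_body q)"
  by (intro linearI) (simp_all add: to_body_def imq_simps vecq_simps algebra_simps)

lemma linear_frame_rotation: "linear (frame_rotation w)"
  by (intro linearI) (simp_all add: frame_rotation_def algebra_simps cross_add_left cross_mult_left)

lemma to_earth_to_body: "q \<noteq> 0 \<Longrightarrow> to_earth q (to_body q h) = h"
  unfolding to_earth_def to_body_def fst_conv snd_conv imq_vecq_conjugate
  by (simp add: mult.assoc inverse_mult_cancel)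

lemma to_body_to_earth: "q \<noteq> 0 \<Longrightarrow> to_body q (to_earth q h) = h"
  unfolding to_earth_def to_body_def fst_conv snd_conv imq_vecq_conjugate
  by (simp add: mult.assoc inverse_mult_cancel)

lemma norm_to_earth: "norm q = 1 \<Longrightarrow> norm (to_earth q h) = norm h"
  by (simp add: to_earth_def norm_prod_def norm_mult norm_inverse imq_vecq_conjugate
      flip: norm_imq)

text \<open>Differentiating the conjugation by \<open>q t\<close> produces a commutator with
  \<open>imq w\<close>, that is, a cross product, and this offsets \<open>frame_rotation\<close>.
  Here the input \<open>\<omega>\<close> disappears from the error equation.\<close>

lemma to_earth_derivative:
  assumes q: "(q has_vector_derivative (1/2) *\<^sub>R (q t * imq w)) (at t within S)" "q t \<noteq> 0"
    and h: "(h has_vector_derivative h') (at t within S)"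
  shows "((\<lambda>t. to_earth (q t) (h t)) has_vector_derivative
    to_earth (q t) (h' - frame_rotation w (h t))) (at t within S)"
proof -
  define I where "I = inverse (q t)"
  have I: "I * (q t * z) = z" "q t * (I * z) = z" "I * q t = 1" "q t * I = 1" for z
    using q(2) by (simp_all add: I_def inverse_mult_cancel)
  have i: "((\<lambda>t. inverse (q t)) has_vector_derivative - ((1/2) *\<^sub>R (imq w * I))) (at t within S)"
    using inverse_has_vector_derivative[OF q] by (simp add: I_def[symmetric] I mult.assoc)
  note h1 = bounded_linear.has_vector_derivative[OF bounded_linear_fst h]
  note h2 = bounded_linear.has_vector_derivative[OF bounded_linear_snd h]
  have "((\<lambda>t. fst (h t) * inverse (q t)) has_vector_derivative
     (fst h' - (1/2) *\<^sub>R (fst (h t) * imq w)) * I) (at t within S)"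
    by (rule has_vector_derivative_eq_rhs[OF has_vector_derivative_mult[OF h1 i]])
      (simp add: I_def[symmetric] algebra_simps)
  moreover have "((\<lambda>t. vecq (q t * imq (snd (h t)) * inverse (q t))) has_vector_derivative
     vecq (q t * imq (snd h' - cross3 (snd (h t)) w) * I)) (at t within S)"
    by (rule has_vector_derivative_eq_rhs[OF vecq_has_vector_derivative[OF
          has_vector_derivative_mult[OF has_vector_derivative_mult[OF q(1) imq_has_vector_derivative[OF h2]] i]]])
      (rule arg_cong[where f = vecq],
        simp add: I_def[symmetric] imq_simps imq_cross3 algebra_simps flip: scaleR_add_left)
  ultimately show ?thesis
    unfolding to_earth_def frame_rotation_def I_def
    by (auto intro!: derivative_eq_intros simp: has_vector_derivative_Pair)
qed

text \<open>The reverse passage restores the rotation term; it turns error solutions back into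
  observer solutions.\<close>

lemma to_body_derivative:
  assumes q: "(q has_vector_derivative (1/2) *\<^sub>R (q t * imq w)) (at t within S)" "q t \<noteq> 0"
    and h: "(h has_vector_derivative h') (at t within S)"
  shows "((\<lambda>t. to_body (q t) (h t)) has_vector_derivative
    to_body (q t) h' + frame_rotation w (to_body (q t) (h t))) (at t within S)"
proof -
  define I where "I = inverse (q t)"
  have I: "I * (q t * z) = z" "q t * (I * z) = z" "I * q t = 1" "q t * I = 1" for z
    using q(2) by (simp_all add: I_def inverse_mult_cancel)
  have i: "((\<lambda>t. inverse (q t)) has_vector_derivative - ((1/2) *\<^sub>R (imq w * I))) (at t within S)"
    using inverse_has_vector_derivative[OF q] by (simp add: I_def[symmetric] I mult.assoc)
  note h1 = bounded_linear.has_vector_derivative[OF bounded_linear_fst h]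
  note h2 = bounded_linear.has_vector_derivative[OF bounded_linear_snd h]
  have "((\<lambda>t. fst (h t) * q t) has_vector_derivative
     fst h' * q t + (1/2) *\<^sub>R (fst (h t) * q t * imq w)) (at t within S)"
    by (rule has_vector_derivative_eq_rhs[OF has_vector_derivative_mult[OF h1 q(1)]])
      (simp add: algebra_simps)
  moreover have "((\<lambda>t. vecq (inverse (q t) * imq (snd (h t)) * q t)) has_vector_derivative
     vecq (I * imq (snd h') * q t) + cross3 (vecq (I * imq (snd (h t)) * q t)) w) (at t within S)"
  proof (rule has_vector_derivative_eq_rhs[OF vecq_has_vector_derivative[OF
          has_vector_derivative_mult[OF has_vector_derivative_mult[OF i imq_has_vector_derivative[OF h2]] q(1)]]])
    have "cross3 (vecq (I * imq (snd (h t)) * q t)) w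
       = vecq (imq (cross3 (vecq (I * imq (snd (h t)) * q t)) w))"
      by simp
    also have "\<dots> = vecq ((I * imq (snd (h t)) * q t * imq w - imq w * (I * imq (snd (h t)) * q t)) /\<^sub>R 2)"
      by (simp add: imq_cross3 I_def imq_vecq_conjugate)
    finally show "vecq (inverse (q t) * imq (snd (h t)) * (1/2) *\<^sub>R (q t * imq w) +
        (inverse (q t) * imq (snd h') + - ((1/2) *\<^sub>R (imq w * I)) * imq (snd (h t))) * q t)
      = vecq (I * imq (snd h') * q t) + cross3 (vecq (I * imq (snd (h t)) * q t)) w"
      by (simp add: I_def[symmetric] vecq_simps[symmetric] algebra_simps)
  qed
  ultimately show ?thesis
    unfolding to_body_def frame_rotation_def I_def
    by (auto intro!: derivative_eq_intros simp: has_vector_derivative_Pair mult.assoc)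
qed

section \<open>The observer in invariant coordinates\<close>

lemma inv_error_eq: "inv_error x z = to_earth (fst x) (z - (0, snd x))"
  by (simp add: inv_error_def to_earth_def)

lemma system_field_eq:
  "system_field A \<omega> a t x = frame_rotation (\<omega> t) x + (0, vecq (inverse (fst x) * imq A * fst x) + a t)"
  by (simp add: system_field_def frame_rotation_def case_prod_beta)

text \<open>The correction terms see \<open>x\<close> and \<open>z\<close> only through the
  invariant error. Gravity is written at the true attitude instead of the estimated one, and the
  difference is the term \<open>- A\<close> of the error field. The forcing thus agrees with that of
  the system and cancels in the error.\<close>

lemma observer_field_eq:
  assumes x: "fst x \<noteq> 0" and z: "fst z \<noteq> 0" and y: "y t = system_output B x"
  shows "observer_field A B Lqv Lqb Lvv Lvb \<omega> a y t z =
    frame_rotation (\<omega> t) z + (0, vecq (inverse (fst x) * imq A * fst x) + a t)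
      + to_body (fst x) (error_field A B Lqv Lqb Lvv Lvb (inv_error x z))"
proof -
  obtain q v where xq: "x = (q, v)" by (cases x)
  obtain p u where zp: "z = (p, u)" by (cases z)
  define I J where "I = inverse q" and "J = inverse p"
  have I: "I * (q * c) = c" "q * (I * c) = c" "I * q = 1" "q * I = 1" for c
    using x by (simp_all add: I_def xq inverse_mult_cancel)
  have J: "J * (p * c) = c" "p * (J * c) = c" "J * p = 1" "p * J = 1" for c
    using z by (simp_all add: J_def zp inverse_mult_cancel)
  have inv: "inverse (p * I) = q * J"
    using x z by (simp add: I_def J_def xq zp nonzero_inverse_mult_distrib)
  have c: "imq (vecq (I * imq c * q)) = I * imq c * q" "imq (vecq (q * imq c * I)) = q * imq c * I"
    "imq (vecq (q * J * imq c * (p * I))) = q * J * imq c * (p * I)" for c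
    using imq_vecq_conjugate(2)[of "p * I" c]
    by (simp_all add: I_def[unfolded] imq_vecq_conjugate inv[unfolded I_def])
  define Ev where "Ev = vecq (p * imq (u - v) * J)"
  define Eb where "Eb = B - vecq (p * (I * imq B * q) * J)"
  have e: "error_field A B Lqv Lqb Lvv Lvb (inv_error x z) =
     (imq (Lqv *v Ev + Lqb *v Eb) * (p * I),
      vecq (q * J * imq (A + Lvv *v Ev + Lvb *v Eb) * (p * I)) - A)"
  proof -
    have "p * I * imq (vecq (q * imq (u - v) * I)) * (q * J) = p * imq (u - v) * J"
      unfolding c by (simp add: mult.assoc I)
    moreover have "p * I * imq B * (q * J) = p * (I * imq B * q) * J"
      by (simp add: mult.assoc)
    ultimately show ?thesis
      unfolding error_field_def inv_error_def Let_def
      by (simp add: xq zp inv Ev_def Eb_def I_def[symmetric])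
  qed
  have o: "observer_field A B Lqv Lqb Lvv Lvb \<omega> a y t z =
     ((1/2) *\<^sub>R (p * imq (\<omega> t)) + imq (Lqv *v Ev + Lqb *v Eb) * p,
      cross3 u (\<omega> t) + vecq (J * imq A * p) + a t + vecq (J * imq (Lvv *v Ev + Lvb *v Eb) * p))"
    by (simp add: observer_field_def Let_def y system_output_def xq zp Ev_def Eb_def
        I_def[symmetric] J_def[symmetric] c)
  define Z where "Z = A + Lvv *v Ev + Lvb *v Eb"
  have "imq (vecq (q * J * imq Z * (p * I)) - A) = q * J * imq Z * (p * I) - imq A"
    by (simp only: imq_simps c)
  then have "vecq (I * imq (vecq (q * J * imq Z * (p * I)) - A) * q)
      = vecq (J * imq Z * p) - vecq (I * imq A * q)"
    by (simp only:) (simp add: algebra_simps mult.assoc I J vecq_simps)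
  moreover have "vecq (J * imq Z * p) = vecq (J * imq A * p) + vecq (J * imq (Lvv *v Ev + Lvb *v Eb) * p)"
    by (simp add: Z_def imq_simps vecq_simps algebra_simps)
  ultimately show ?thesis
    unfolding o e to_body_def frame_rotation_def
    by (simp add: xq zp I_def[symmetric] Z_def[symmetric] mult.assoc I)
qed

text \<open>The inverse of \<open>inv_error x\<close>.\<close>

definition estimate_of :: "state \<Rightarrow> state \<Rightarrow> state" where
  "estimate_of x \<eta> = to_body (fst x) \<eta> + (0, snd x)"

lemma inv_error_estimate_of: "fst x \<noteq> 0 \<Longrightarrow> inv_error x (estimate_of x \<eta>) = \<eta>"
  by (simp add: inv_error_eq estimate_of_def to_earth_to_body)

lemma estimate_of_inv_error: "fst x \<noteq> 0 \<Longrightarrow> estimate_of x (inv_error x z) = z"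
  by (simp add: inv_error_eq estimate_of_def to_body_to_earth)

lemma inv_error_in_state_space:
  "x \<in> state_space \<Longrightarrow> z \<in> state_space \<Longrightarrow> inv_error x z \<in> state_space"
  by (simp add: state_space_def inv_error_def norm_mult norm_inverse)

lemma estimate_of_in_state_space:
  "x \<in> state_space \<Longrightarrow> \<eta> \<in> state_space \<Longrightarrow> estimate_of x \<eta> \<in> state_space"
  by (simp add: state_space_def estimate_of_def to_body_def norm_mult)

lemma state_space_nonzero: "x \<in> state_space \<Longrightarrow> fst x \<noteq> 0"
  by (auto simp: state_space_def)

lemma system_solution_derivatives:
  assumes x: "ode_solution state_space (system_field A \<omega> a) x" and t: "t \<ge> 0"
  shows "((\<lambda>t. fst (x t)) has_vector_derivative (1/2) *\<^sub>R (fst (x t) * imq (\<omega> t))) (at t within {0..})"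
    and "((\<lambda>t. (0, snd (x t)) :: state) has_vector_derivative
       frame_rotation (\<omega> t) (0, snd (x t)) + (0, vecq (inverse (fst (x t)) * imq A * fst (x t)) + a t))
       (at t within {0..})"
proof -
  have x': "(x has_vector_derivative system_field A \<omega> a t (x t)) (at t within {0..})"
    using x t by (simp add: ode_solution_def)
  show "((\<lambda>t. fst (x t)) has_vector_derivative (1/2) *\<^sub>R (fst (x t) * imq (\<omega> t))) (at t within {0..})"
    using bounded_linear.has_vector_derivative[OF bounded_linear_fst x']
    by (simp add: system_field_eq frame_rotation_def)
  show "((\<lambda>t. (0, snd (x t)) :: state) has_vector_derivative
       frame_rotation (\<omega> t) (0, snd (x t)) + (0, vecq (inverse (fst (x t)) * imq A * fst (x t)) + a t))
       (at t within {0..})"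
    using has_vector_derivative_Pair[OF has_vector_derivative_const[of 0]
      bounded_linear.has_vector_derivative[OF bounded_linear_snd x']]
    by (simp add: system_field_eq frame_rotation_def)
qed

text \<open>In the derivative of \<open>xh t - (0, snd (x t))\<close> the common forcing cancels;
  what is left is the rotation of this difference, removed by \<open>to_earth_derivative\<close>,
  and the error field in body coordinates.\<close>

lemma observer_solution_error:
  assumes x: "ode_solution state_space (system_field A \<omega> a) x"
    and xh: "ode_solution state_space
       (observer_field A B Lqv Lqb Lvv Lvb \<omega> a (\<lambda>t. system_output B (x t))) xh"
  shows "ode_solution state_space (\<lambda>_. error_field A B Lqv Lqb Lvv Lvb) (\<lambda>t. inv_error (x t) (xh t))"
  unfolding ode_solution_def
proof (intro allI impI conjI)
  fix t :: real assume t: "t \<ge> 0"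
  have S: "x t \<in> state_space" "xh t \<in> state_space"
    using x xh t by (simp_all add: ode_solution_def)
  show "inv_error (x t) (xh t) \<in> state_space"
    using S by (rule inv_error_in_state_space)
  have xh': "(xh has_vector_derivative observer_field A B Lqv Lqb Lvv Lvb \<omega> a (\<lambda>t. system_output B (x t)) t (xh t))
     (at t within {0..})"
    using xh t by (simp add: ode_solution_def)
  note x' = system_solution_derivatives[OF x t]
  have "frame_rotation (\<omega> t) (xh t) = frame_rotation (\<omega> t) (xh t - (0, snd (x t))) + frame_rotation (\<omega> t) (0, snd (x t))"
    by (simp flip: linear_add[OF linear_frame_rotation])
  with to_earth_derivative[OF x'(1) state_space_nonzero[OF S(1)] has_vector_derivative_diff[OF xh' x'(2)]]
  have "((\<lambda>t. to_earth (fst (x t)) (xh t - (0, snd (x t)))) has_vector_derivative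
     error_field A B Lqv Lqb Lvv Lvb (inv_error (x t) (xh t))) (at t within {0..})"
    using S[THEN state_space_nonzero]
    by (simp add: observer_field_eq[of "x t"] to_earth_to_body)
  then show "((\<lambda>t. inv_error (x t) (xh t)) has_vector_derivative
     error_field A B Lqv Lqb Lvv Lvb (inv_error (x t) (xh t))) (at t within {0..})"
    by (simp only: inv_error_eq)
qed

text \<open>The source of observer solutions: an error solution is transported along the trajectory,
  so no time-dependent equation has to be solved.\<close>

lemma error_solution_estimate:
  assumes x: "ode_solution state_space (system_field A \<omega> a) x"
    and \<eta>: "ode_solution state_space (\<lambda>_. error_field A B Lqv Lqb Lvv Lvb) \<eta>"
  shows "ode_solution state_space
     (observer_field A B Lqv Lqb Lvv Lvb \<omega> a (\<lambda>t. system_output B (x t))) (\<lambda>t. estimate_of (x t) (\<eta> t))"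
  unfolding ode_solution_def
proof (intro allI impI conjI)
  fix t :: real assume t: "t \<ge> 0"
  have S: "x t \<in> state_space" "\<eta> t \<in> state_space"
    using x \<eta> t by (simp_all add: ode_solution_def)
  show "estimate_of (x t) (\<eta> t) \<in> state_space"
    using S by (rule estimate_of_in_state_space)
  then have nz: "fst (estimate_of (x t) (\<eta> t)) \<noteq> 0"
    by (rule state_space_nonzero)
  have \<eta>': "(\<eta> has_vector_derivative error_field A B Lqv Lqb Lvv Lvb (\<eta> t)) (at t within {0..})"
    using \<eta> t by (simp add: ode_solution_def)
  note x' = system_solution_derivatives[OF x t]
  have "frame_rotation (\<omega> t) (estimate_of (x t) (\<eta> t)) =
      frame_rotation (\<omega> t) (to_body (fst (x t)) (\<eta> t)) + frame_rotation (\<omega> t) (0, snd (x t))"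
    by (simp add: estimate_of_def linear_add[OF linear_frame_rotation])
  then show "((\<lambda>t. estimate_of (x t) (\<eta> t)) has_vector_derivative
     observer_field A B Lqv Lqb Lvv Lvb \<omega> a (\<lambda>t. system_output B (x t)) t (estimate_of (x t) (\<eta> t)))
     (at t within {0..})"
    unfolding observer_field_eq[where x = "x t" and y = "\<lambda>t. system_output B (x t)" and t = t, OF state_space_nonzero[OF S(1)] nz refl]
      inv_error_estimate_of[OF state_space_nonzero[OF S(1)]]
    unfolding estimate_of_def
    by (intro has_vector_derivative_eq_rhs[OF has_vector_derivative_add[OF
          to_body_derivative[OF x'(1) state_space_nonzero[OF S(1)] \<eta>'] x'(2)]])
      (simp add: algebra_simps)
qed

section \<open>The error field near the identity\<close>

lemma lipschitz_on_norm_bound: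
  fixes f :: "'a::metric_space \<Rightarrow> 'b::real_normed_vector"
  assumes L: "L-lipschitz_on S f" and S: "bounded S"
  obtains M where "\<And>x. x \<in> S \<Longrightarrow> norm (f x) \<le> M"
proof (cases "S = {}")
  case False
  then obtain a where a: "a \<in> S" by blast
  obtain e where e: "\<And>x. x \<in> S \<Longrightarrow> dist a x \<le> e"
    using S unfolding bounded_any_center[of _ a] by blast
  have "norm (f x) \<le> norm (f a) + L * e" if x: "x \<in> S" for x
  proof -
    have "norm (f x) \<le> norm (f a) + dist (f a) (f x)"
      unfolding dist_norm by norm
    also have "dist (f a) (f x) \<le> L * dist a x"
      using lipschitz_onD[OF L a x] .
    also have "\<dots> \<le> L * e"
      using e[OF x] lipschitz_on_nonneg[OF L] by (intro mult_left_mono)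
    finally show ?thesis by simp
  qed
  then show thesis by (rule that)
qed (use that in auto)

text \<open>A product rule, with the factors bounded because \<open>S\<close> is. The existential
  form lets such rules be applied along the structure of a field without tracking constants.\<close>

lemma lipschitz_bounded_bilinear:
  fixes prod :: "'a::real_normed_vector \<Rightarrow> 'b::real_normed_vector \<Rightarrow> 'c::real_normed_vector"
    and f :: "'d::metric_space \<Rightarrow> 'a"
  assumes prod: "bounded_bilinear prod" and S: "bounded S"
    and f: "\<exists>L. L-lipschitz_on S f" and g: "\<exists>L. L-lipschitz_on S g"
  shows "\<exists>L. L-lipschitz_on S (\<lambda>x. prod (f x) (g x))"
proof -
  interpret bounded_bilinear prod by (rule prod)
  obtain L1 L2 where L: "L1-lipschitz_on S f" "L2-lipschitz_on S g"
    using f g by blast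
  obtain M1 where M1: "\<And>x. x \<in> S \<Longrightarrow> norm (f x) \<le> M1"
    using lipschitz_on_norm_bound[OF L(1) S] by blast
  obtain M2 where M2: "\<And>x. x \<in> S \<Longrightarrow> norm (g x) \<le> M2"
    using lipschitz_on_norm_bound[OF L(2) S] by blast
  obtain K where K: "K \<ge> 0" "\<And>a b. norm (prod a b) \<le> norm a * norm b * K"
    using nonneg_bounded by blast
  note L0 = L[THEN lipschitz_on_nonneg]
  have "(\<bar>M1\<bar> * L2 * K + L1 * \<bar>M2\<bar> * K)-lipschitz_on S (\<lambda>x. prod (f x) (g x))"
  proof (rule lipschitz_onI)
    fix x y assume xy: "x \<in> S" "y \<in> S"
    have "prod (f x) (g x) - prod (f y) (g y) = prod (f x) (g x - g y) + prod (f x - f y) (g y)"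
      by (simp add: diff_left diff_right)
    then have "dist (prod (f x) (g x)) (prod (f y) (g y))
        \<le> norm (f x) * norm (g x - g y) * K + norm (f x - f y) * norm (g y) * K"
      unfolding dist_norm by (metis K(2) add_mono norm_triangle_mono)
    also have "\<dots> \<le> \<bar>M1\<bar> * (L2 * dist x y) * K + (L1 * dist x y) * \<bar>M2\<bar> * K"
      using M1[OF xy(1)] M2[OF xy(2)] K(1) L0 lipschitz_onD[OF L(1) xy] lipschitz_onD[OF L(2) xy]
      by (intro add_mono mult_right_mono mult_mono) (auto simp: dist_norm)
    finally show "dist (prod (f x) (g x)) (prod (f y) (g y))
        \<le> (\<bar>M1\<bar> * L2 * K + L1 * \<bar>M2\<bar> * K) * dist x y"
      by (simp add: algebra_simps)
  qed (use L0 K in auto)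
  then show ?thesis by blast
qed

lemma lipschitz_bounded_linear:
  assumes "bounded_linear h" and "\<exists>L. L-lipschitz_on S f"
  shows "\<exists>L. L-lipschitz_on S (\<lambda>x. h (f x))"
proof -
  obtain M where "M-lipschitz_on (f ` S) h"
    using bounded_linear.lipschitz_boundE[OF assms(1)] by blast
  with assms(2) show ?thesis
    by (blast intro: lipschitz_on_compose2)
qed

lemma lipschitz_add_ex:
  fixes f g :: "'a::metric_space \<Rightarrow> 'b::real_normed_vector"
  shows "\<exists>L. L-lipschitz_on S f \<Longrightarrow> \<exists>L. L-lipschitz_on S g \<Longrightarrow> \<exists>L. L-lipschitz_on S (\<lambda>x. f x + g x)"
  by (blast intro: lipschitz_on_add)

lemma lipschitz_diff_ex:
  fixes f g :: "'a::metric_space \<Rightarrow> 'b::real_normed_vector"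
  shows "\<exists>L. L-lipschitz_on S f \<Longrightarrow> \<exists>L. L-lipschitz_on S g \<Longrightarrow> \<exists>L. L-lipschitz_on S (\<lambda>x. f x - g x)"
  by (blast intro: lipschitz_on_diff)

lemma lipschitz_Pair_ex:
  "\<exists>L. L-lipschitz_on S f \<Longrightarrow> \<exists>L. L-lipschitz_on S g \<Longrightarrow> \<exists>L. L-lipschitz_on S (\<lambda>x. (f x, g x))"
  by (blast intro: lipschitz_on_Pair)

lemma lipschitz_const_ex: "\<exists>L. L-lipschitz_on S (\<lambda>x. c)"
  by (blast intro: lipschitz_on_constant)

text \<open>The difference of two inverses is, up to sign, the difference of the arguments between
  the two inverses, and each inverse has norm at most \<open>1 / r\<close>.\<close>

lemma lipschitz_inverse_ex:
  fixes f :: "'a::metric_space \<Rightarrow> 'b::real_normed_div_algebra"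
  assumes r: "r > 0" "\<And>x. x \<in> S \<Longrightarrow> r \<le> norm (f x)" and f: "\<exists>L. L-lipschitz_on S f"
  shows "\<exists>L. L-lipschitz_on S (\<lambda>x. inverse (f x))"
proof -
  have "(1 / r * (1 / r))-lipschitz_on (f ` S) inverse"
  proof (rule lipschitz_onI)
    fix a b assume "a \<in> f ` S" "b \<in> f ` S"
    then have ab: "r \<le> norm a" "r \<le> norm b"
      using r by auto
    then have nz: "a \<noteq> 0" "b \<noteq> 0"
      using r(1) by auto
    have "dist (inverse a) (inverse b) = (1 / norm a) * norm (a - b) * (1 / norm b)"
      using nz by (simp add: dist_norm inverse_diff_inverse norm_mult norm_inverse divide_inverse)
    also have "\<dots> \<le> (1 / r) * norm (a - b) * (1 / r)"
      using ab r(1) by (intro mult_mono mult_right_mono) (auto intro!: frac_le)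
    finally show "dist (inverse a) (inverse b) \<le> 1 / r * (1 / r) * dist a b"
      by (simp add: dist_norm)
  qed (use r in auto)
  with f show ?thesis
    by (blast intro: lipschitz_on_compose2)
qed

text \<open>All ingredients are linear or bilinear except the inverse of the quaternion, which
  requires the lower bound \<open>r\<close>. It is 1 on the state space and 1/2 in a neighbourhood
  of the identity.\<close>

lemma error_field_lipschitz:
  assumes S: "bounded S" and r: "r > 0" "\<And>x. x \<in> S \<Longrightarrow> r \<le> norm (fst x)"
  shows "\<exists>L. L-lipschitz_on S (error_field A B Lqv Lqb Lvv Lvb)"
proof -
  have id: "\<exists>L. L-lipschitz_on S (\<lambda>x. x)"
    by (blast intro: lipschitz_on_id)
  note q = lipschitz_bounded_linear[OF bounded_linear_fst id]
    and v = lipschitz_bounded_linear[OF bounded_linear_snd id]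
  note i = lipschitz_inverse_ex[OF r q]
  note intros = lipschitz_bounded_bilinear[OF bounded_bilinear_mult S] q v i
    lipschitz_bounded_linear[OF bounded_linear_imq] lipschitz_bounded_linear[OF bounded_linear_vecq]
    lipschitz_bounded_linear[OF matrix_vector_mul_bounded_linear]
    lipschitz_add_ex lipschitz_diff_ex lipschitz_const_ex lipschitz_Pair_ex
  show ?thesis
    unfolding error_field_def case_prod_beta Let_def
    by (intro intros)
qed

lemma error_solution_unique:
  assumes \<eta>: "ode_solution state_space (\<lambda>_. error_field A B Lqv Lqb Lvv Lvb) \<eta>"
    and \<zeta>: "ode_solution state_space (\<lambda>_. error_field A B Lqv Lqb Lvv Lvb) \<zeta>"
    and "\<eta> 0 = \<zeta> 0" "t \<ge> 0"
  shows "\<eta> t = \<zeta> t"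
  by (rule ode_solution_unique[OF error_field_lipschitz[where r = 1] \<eta> \<zeta> assms(3,4)])
    (auto simp: state_space_def)

text \<open>The commutators arise from differentiating conjugation at 1. The real part of
  \<open>fst h\<close> commutes with everything and drops out, so the real direction is
  neutral.\<close>

definition error_linearization ::
    "real^3 \<Rightarrow> real^3 \<Rightarrow> real^3^3 \<Rightarrow> real^3^3 \<Rightarrow> real^3^3 \<Rightarrow> real^3^3 \<Rightarrow> state \<Rightarrow> state" where
  "error_linearization A B Lqv Lqb Lvv Lvb h =
     (let Eb = vecq (imq B * fst h - fst h * imq B)
      in (imq (Lqv *v snd h + Lqb *v Eb),
          vecq (imq A * fst h - fst h * imq A) + Lvv *v snd h + Lvb *v Eb))"

lemma error_field_has_derivative:
  "(error_field A B Lqv Lqb Lvv Lvb has_derivative error_linearization A B Lqv Lqb Lvv Lvb) (at (1, 0))"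
proof -
  note matrix = bounded_linear.has_derivative[OF matrix_vector_mul_bounded_linear]
  have i: "((\<lambda>x::state. inverse (fst x)) has_derivative (\<lambda>h. - fst h)) (at (1, 0))"
    by (auto intro!: derivative_eq_intros)
  have v: "((\<lambda>x::state. vecq (fst x * imq (snd x) * inverse (fst x))) has_derivative snd) (at (1, 0))"
    by (rule has_derivative_eq_rhs) (auto intro!: derivative_eq_intros i simp: imq_simps fun_eq_iff)
  have b: "((\<lambda>x::state. B - vecq (fst x * imq B * inverse (fst x))) has_derivative
      (\<lambda>h. vecq (imq B * fst h - fst h * imq B))) (at (1, 0))"
    by (rule has_derivative_eq_rhs)
      (auto intro!: derivative_eq_intros i simp: fun_eq_iff vecq_simps[symmetric])
  define U where "U = (\<lambda>x::state. Lqv *v vecq (fst x * imq (snd x) * inverse (fst x))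
     + Lqb *v (B - vecq (fst x * imq B * inverse (fst x))))"
  define Z where "Z = (\<lambda>x::state. A + Lvv *v vecq (fst x * imq (snd x) * inverse (fst x))
     + Lvb *v (B - vecq (fst x * imq B * inverse (fst x))))"
  have U: "(U has_derivative (\<lambda>h. Lqv *v snd h + Lqb *v vecq (imq B * fst h - fst h * imq B))) (at (1, 0))"
    and Z: "(Z has_derivative (\<lambda>h. Lvv *v snd h + Lvb *v vecq (imq B * fst h - fst h * imq B))) (at (1, 0))"
    unfolding U_def Z_def by (auto intro!: derivative_eq_intros matrix[OF v] matrix[OF b])
  \<comment> \<open>Since \<open>U\<close> vanishes at the equilibrium, the product rule for
    \<open>imq (U x) * fst x\<close> keeps only the derivative of \<open>U\<close>; the value
    \<open>A\<close> of \<open>Z\<close> yields the gravity commutator.\<close>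
  have UZ: "U (1, 0) = 0" "Z (1, 0) = A"
    by (simp_all add: U_def Z_def imq_simps vecq_simps)
  have "((\<lambda>x. (imq (U x) * fst x, vecq (inverse (fst x) * imq (Z x) * fst x) - A))
      has_derivative error_linearization A B Lqv Lqb Lvv Lvb) (at (1, 0))"
    by (rule has_derivative_eq_rhs)
      (auto intro!: derivative_eq_intros i U Z
        simp: UZ fun_eq_iff error_linearization_def Let_def imq_simps vecq_simps algebra_simps)
  then show ?thesis
    by (simp add: error_field_def case_prod_beta' Let_def U_def Z_def)
qed

text \<open>The radial term vanishes on the unit sphere and makes the sphere attractive, so that the
  linearization at \<open>(1, 0)\<close> becomes stable on the whole seven-dimensional space.\<close>

definition damped_error_field ::
    "real^3 \<Rightarrow> real^3 \<Rightarrow> real^3^3 \<Rightarrow> real^3^3 \<Rightarrow> real^3^3 \<Rightarrow> real^3^3 \<Rightarrow> state \<Rightarrow> state" where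
  "damped_error_field A B Lqv Lqb Lvv Lvb x =
     error_field A B Lqv Lqb Lvv Lvb x + ((1 - fst x \<bullet> fst x) *\<^sub>R fst x, 0)"

lemma inner_imq_mult: "q \<bullet> (imq u * q) = 0" "(imq u * q) \<bullet> q = 0"
  by (simp_all add: inner_quat_def imq_def algebra_simps)

text \<open>The error field moves the quaternion orthogonally to itself, so the defect
  \<open>s\<close> obeys \<open>s' = - 2 * s * (p \<bullet> p)\<close> with \<open>p\<close> the
  quaternion part. Its square cannot grow, hence it stays 0 and the damping term is never
  felt.\<close>

lemma damped_error_solution:
  assumes \<eta>: "ode_solution S (\<lambda>_. damped_error_field A B Lqv Lqb Lvv Lvb) \<eta>"
    and "\<eta> 0 \<in> state_space"
  shows "ode_solution state_space (\<lambda>_. error_field A B Lqv Lqb Lvv Lvb) \<eta>"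
proof -
  define s where "s t = 1 - fst (\<eta> t) \<bullet> fst (\<eta> t)" for t
  have \<eta>': "(\<eta> has_vector_derivative damped_error_field A B Lqv Lqb Lvv Lvb (\<eta> t)) (at t within {0..})"
    if "t \<ge> 0" for t
    using \<eta> that by (simp add: ode_solution_def)
  have s0: "s t = 0" if t: "t \<ge> 0" for t
  proof -
    have "(s t)\<^sup>2 \<le> exp (0 * t) * (s 0)\<^sup>2"
    proof (rule exp_growth_bound[where T = t])
      fix \<tau> :: real assume \<tau>: "\<tau> \<ge> 0"
      define p where "p = fst (\<eta> \<tau>)"
      have "\<exists>u. fst (damped_error_field A B Lqv Lqb Lvv Lvb (\<eta> \<tau>)) = imq u * p + s \<tau> *\<^sub>R p"
        unfolding damped_error_field_def error_field_def case_prod_beta Let_def p_def s_def fst_add fst_conv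
        by (rule exI) (rule refl)
      then obtain u where u: "fst (damped_error_field A B Lqv Lqb Lvv Lvb (\<eta> \<tau>)) = imq u * p + s \<tau> *\<^sub>R p" ..
      have "((\<lambda>t. fst (\<eta> t) \<bullet> fst (\<eta> t)) has_real_derivative
          p \<bullet> (imq u * p + s \<tau> *\<^sub>R p) + (imq u * p + s \<tau> *\<^sub>R p) \<bullet> p) (at \<tau> within {0..})"
        using has_real_derivative_bilinear[OF bounded_bilinear_inner
            bounded_linear.has_vector_derivative[OF bounded_linear_fst \<eta>'[OF \<tau>]]
            bounded_linear.has_vector_derivative[OF bounded_linear_fst \<eta>'[OF \<tau>]]]
        by (simp add: u p_def)
      moreover have "p \<bullet> (imq u * p + s \<tau> *\<^sub>R p) + (imq u * p + s \<tau> *\<^sub>R p) \<bullet> p = 2 * s \<tau> * (p \<bullet> p)"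
        by (simp add: inner_add_right inner_add_left inner_imq_mult)
      ultimately have "(s has_real_derivative - (2 * s \<tau> * (p \<bullet> p))) (at \<tau> within {0..})"
        unfolding s_def[abs_def] by (auto intro!: derivative_eq_intros)
      then show "((\<lambda>t. (s t)\<^sup>2) has_real_derivative - (4 * (s \<tau>)\<^sup>2 * (p \<bullet> p))) (at \<tau> within {0..})"
        by (auto intro!: derivative_eq_intros simp: power2_eq_square)
      show "- (4 * (s \<tau>)\<^sup>2 * (p \<bullet> p)) \<le> 0 * (s \<tau>)\<^sup>2"
        by simp
    qed (use t in auto)
    moreover have "s 0 = 0"
      using assms(2) by (simp add: s_def state_space_def dot_square_norm)
    ultimately show ?thesis by simp
  qed
  show ?thesis
    unfolding ode_solution_def
  proof (intro allI impI conjI)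
    fix t :: real assume t: "t \<ge> 0"
    show "\<eta> t \<in> state_space"
      using s0[OF t] by (simp add: s_def state_space_def norm_eq_sqrt_inner)
    show "(\<eta> has_vector_derivative error_field A B Lqv Lqb Lvv Lvb (\<eta> t)) (at t within {0..})"
      using \<eta>'[OF t] s0[OF t] by (simp add: damped_error_field_def s_def zero_prod_def[symmetric])
  qed
qed

lemma inner_one_quat: "q \<bullet> 1 = q0 q" "1 \<bullet> q = q0 q"
  by (simp_all add: inner_quat_def)

lemma damped_error_field_has_derivative:
  "(damped_error_field A B Lqv Lqb Lvv Lvb has_derivative
     (\<lambda>h. error_linearization A B Lqv Lqb Lvv Lvb h + ((- 2 * q0 (fst h)) *\<^sub>R 1, 0))) (at (1, 0))"
proof -
  have "((\<lambda>x::state. ((1 - fst x \<bullet> fst x) *\<^sub>R fst x, 0::real^3)) has_derivative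
      (\<lambda>h. ((- 2 * q0 (fst h)) *\<^sub>R 1, 0))) (at (1, 0))"
    by (rule has_derivative_eq_rhs)
      (auto intro!: derivative_eq_intros simp: fun_eq_iff inner_one_quat algebra_simps)
  from has_derivative_add[OF error_field_has_derivative this]
  show ?thesis
    by (simp add: damped_error_field_def[abs_def])
qed

lemma damped_error_field_lipschitz:
  assumes S: "bounded S" and r: "r > 0" "\<And>x. x \<in> S \<Longrightarrow> r \<le> norm (fst x)"
  shows "\<exists>L. L-lipschitz_on S (damped_error_field A B Lqv Lqb Lvv Lvb)"
proof -
  have id: "\<exists>L. L-lipschitz_on S (\<lambda>x. x)"
    by (blast intro: lipschitz_on_id)
  note q = lipschitz_bounded_linear[OF bounded_linear_fst id]
  show ?thesis
    unfolding damped_error_field_def[abs_def]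
    by (intro lipschitz_add_ex error_field_lipschitz[OF S r] lipschitz_Pair_ex lipschitz_const_ex
        lipschitz_bounded_bilinear[OF bounded_bilinear_scaleR S]
        lipschitz_bounded_bilinear[OF bounded_bilinear_inner S] lipschitz_diff_ex q)
qed

section \<open>The four subsystems and exponential stability of the error equation\<close>

lemma longitudinal_field_eq: "longitudinal_field a_grav M21 N11 = planar_field M21 (2 * a_grav) N11"
  by (simp add: longitudinal_field_def planar_field_def fun_eq_iff vec_eq_iff forall_2
      matrix_vector_mult_def sum_2)

lemma lateral_field_eq: "lateral_field a_grav M12 N22 = planar_field (- M12) (- 2 * a_grav) N22"
  by (simp add: lateral_field_def planar_field_def fun_eq_iff vec_eq_iff forall_2
      matrix_vector_mult_def sum_2)

lemma scalar_stable_neg: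
  assumes "asymptotically_stable (\<lambda>z. - k * z :: real)"
  shows "k > 0"
proof -
  have "linear (\<lambda>z. - k * z :: real)"
    by (intro linearI) (simp_all add: algebra_simps)
  from linear_stable_eigenvalue_neg[OF this assms, of 1 "- k"] show ?thesis
    by simp
qed

text \<open>The indirect method is applied to the damped field, shifted so that its equilibrium is
  0; for starts on the sphere \<open>damped_error_solution\<close> removes the damping
  again.\<close>

lemma error_field_exponentially_stable:
  fixes A B :: "real^3" and Lqv Lqb Lvv :: "real^3^3"
  assumes A: "A = vector [0, 0, a_grav]"
    and Lqv: "Lqv = vector [vector [0, - M12, 0], vector [M21, 0, 0], vector [0, 0, 0]]"
    and Lvv: "Lvv = - vector [vector [N11, 0, 0], vector [0, N22, 0], vector [0, 0, N33]]"
    and Lqb: "Lqb = vector [vector [0, 0, 0], vector [0, 0, 0], vector [- lam * B$2, lam * B$1, 0]]"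
    and longitudinal: "asymptotically_stable (longitudinal_field a_grav M21 N11)"
    and lateral: "asymptotically_stable (lateral_field a_grav M12 N22)"
    and vertical: "asymptotically_stable (vertical_field N33)"
    and heading: "asymptotically_stable (heading_field B lam 0 0)"
  obtains \<epsilon> C \<mu> where "\<epsilon> > 0" "C > 0" "\<mu> > 0"
    "\<And>z. z \<in> state_space \<Longrightarrow> dist z (1, 0) < \<epsilon> \<Longrightarrow>
       \<exists>\<eta>. \<eta> 0 = z \<and> ode_solution state_space (\<lambda>_. error_field A B Lqv Lqb Lvv 0) \<eta> \<and>
         (\<forall>t\<ge>0. dist (\<eta> t) (1, 0) \<le> C * exp (- \<mu> * t) * dist z (1, 0))"
proof -
  have long: "N11 > 0" "M21 * (2 * a_grav) > 0" and lat: "N22 > 0" "- M12 * (- 2 * a_grav) > 0"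
    using longitudinal lateral planar_stable_trace planar_stable_det
    unfolding longitudinal_field_eq lateral_field_eq by blast+
  have N33: "N33 > 0"
    using scalar_stable_neg[of N33] vertical by (simp add: vertical_field_def[abs_def])
  define h where "h = 2 * lam * ((B$1)\<^sup>2 + (B$2)\<^sup>2)"
  have h: "h > 0"
    using scalar_stable_neg[of h] heading by (simp add: heading_field_def[abs_def] h_def)
  obtain p1 r1 s1 where long_pos: "\<And>y z. (y, z) \<noteq> (0, 0) \<Longrightarrow> p1 * y\<^sup>2 + 2 * r1 * y * z + s1 * z\<^sup>2 > 0"
    and long_der: "\<And>y z. p1 * y * (M21 * z) + r1 * (y * (- (2 * a_grav) * y - N11 * z) + z * (M21 * z))
        + s1 * z * (- (2 * a_grav) * y - N11 * z) = - (y\<^sup>2 + z\<^sup>2) / 2"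
    using planar_lyapunov_form[OF long] by metis
  obtain p2 r2 s2 where lat_pos: "\<And>y z. (y, z) \<noteq> (0, 0) \<Longrightarrow> p2 * y\<^sup>2 + 2 * r2 * y * z + s2 * z\<^sup>2 > 0"
    and lat_der: "\<And>y z. p2 * y * (- M12 * z) + r2 * (y * (- (- 2 * a_grav) * y - N22 * z) + z * (- M12 * z))
        + s2 * z * (- (- 2 * a_grav) * y - N22 * z) = - (y\<^sup>2 + z\<^sup>2) / 2"
    using planar_lyapunov_form[OF lat] by metis
  define m1 m2 where "m1 = 2 * lam * B$3 * B$1" and "m2 = 2 * lam * B$3 * B$2"
  \<comment> \<open>Along the linearization a planar form of weight \<open>K\<close> contributes
    \<open>- K / 2\<close> times the squared norm of its pair. This covers the remainders
    \<open>m1\<^sup>2 / h\<close> and \<open>m2\<^sup>2 / h\<close> of the heading coupling and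
    leaves one full unit.\<close>
  define K where "K = 2 * (m1\<^sup>2 / h + m2\<^sup>2 / h + 1)"
  have K: "K > 0"
    using h by (simp add: K_def add_nonneg_pos)
  define lo where "lo x = (q2 (fst x), snd x $ 1)" for x :: state
  define la where "la x = (q1 (fst x), snd x $ 2)" for x :: state
  define Q where "Q p r s z w = p * fst z * fst w + r * (fst z * snd w + snd z * fst w) + s * snd z * snd w"
    for p r s :: real and z w :: "real \<times> real"
  \<comment> \<open>The planar pairs enter through their Lyapunov forms, the remaining coordinates
    through squares. \<open>Q\<close> is polarized since the method works with a bilinear
    \<open>W\<close>.\<close>
  define W where "W x y = q0 (fst x) * q0 (fst y) + q3 (fst x) * q3 (fst y) + snd x $ 3 * snd y $ 3
    + K * (Q p1 r1 s1 (lo x) (lo y) + Q p2 r2 s2 (la x) (la y))" for x y :: state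
  define D where "D = (\<lambda>x::state. error_linearization A B Lqv Lqb Lvv 0 x + ((- 2 * q0 (fst x)) *\<^sub>R 1, 0))"
  have "bilinear W"
    unfolding bilinear_def W_def Q_def lo_def la_def
    by (auto intro!: linearI simp: algebra_simps)
  then have W: "bounded_bilinear W"
    by (simp add: bilinear_conv_bounded_bilinear)
  have sym: "W x y = W y x" for x y
    by (simp add: W_def Q_def algebra_simps)
  have nz: "q0 (fst x) \<noteq> 0 \<or> q3 (fst x) \<noteq> 0 \<or> snd x $ 3 \<noteq> 0 \<or> lo x \<noteq> (0, 0) \<or> la x \<noteq> (0, 0)"
    if "x \<noteq> 0" for x
    using that by (auto simp: lo_def la_def prod_eq_iff quat_eq_iff vec_eq_iff forall_3)
  have Qpos: "Q p r s z z \<ge> 0 \<and> (z \<noteq> (0, 0) \<longrightarrow> Q p r s z z > 0)"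
    if "\<And>y z. (y, z) \<noteq> (0, 0) \<Longrightarrow> p * y\<^sup>2 + 2 * r * y * z + s * z\<^sup>2 > 0" for p r s z
  proof (cases "z = (0, 0)")
    case False
    have "Q p r s z z = p * (fst z)\<^sup>2 + 2 * r * fst z * snd z + s * (snd z)\<^sup>2"
      by (simp add: Q_def power2_eq_square algebra_simps)
    then have "Q p r s z z > 0"
      using that[of "fst z" "snd z"] False by simp
    then show ?thesis by simp
  qed (simp add: Q_def)
  have pos: "W x x > 0" if "x \<noteq> 0" for x
  proof -
    note Q1 = Qpos[OF long_pos, of "lo x"] and Q2 = Qpos[OF lat_pos, of "la x"]
    have eq: "W x x = (q0 (fst x))\<^sup>2 + (q3 (fst x))\<^sup>2 + (snd x $ 3)\<^sup>2
        + K * Q p1 r1 s1 (lo x) (lo x) + K * Q p2 r2 s2 (la x) (la x)"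
      by (simp add: W_def power2_eq_square algebra_simps)
    have nonneg: "K * Q p1 r1 s1 (lo x) (lo x) \<ge> 0" "K * Q p2 r2 s2 (la x) (la x) \<ge> 0"
      using K Q1 Q2 by simp_all
    have "0 < (q0 (fst x))\<^sup>2 \<or> 0 < (q3 (fst x))\<^sup>2 \<or> 0 < (snd x $ 3)\<^sup>2
        \<or> 0 < K * Q p1 r1 s1 (lo x) (lo x) \<or> 0 < K * Q p2 r2 s2 (la x) (la x)"
      using nz[OF that] K Q1 Q2 by auto
    then show ?thesis
      unfolding eq using nonneg zero_le_power2[of "q0 (fst x)"] zero_le_power2[of "q3 (fst x)"]
        zero_le_power2[of "snd x $ 3"] by linarith
  qed
  \<comment> \<open>The weight \<open>h / 4\<close> is such that the two coupling terms together use
    up half of the heading damping \<open>h * c3\<^sup>2\<close>.\<close>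
  have young: "u * v \<le> h / 4 * u\<^sup>2 + v\<^sup>2 / h" for u v :: real
  proof -
    have "0 \<le> (h * u / 2 - v)\<^sup>2 / h"
      using h by simp
    also have "\<dots> = h / 4 * u\<^sup>2 + v\<^sup>2 / h - u * v"
      using h by (simp add: power2_eq_square field_simps)
    finally show ?thesis by simp
  qed
  have neg: "W x (D x) < 0" if "x \<noteq> 0" for x
  proof -
    define c0 c1 c2 c3 where "c0 = q0 (fst x)" and "c1 = q1 (fst x)" and "c2 = q2 (fst x)" and "c3 = q3 (fst x)"
    define v1 v2 v3 where "v1 = snd x $ 1" and "v2 = snd x $ 2" and "v3 = snd x $ 3"
    \<comment> \<open>A commutator of imaginary quaternions is twice their cross product, whence the
      factors 2 with \<open>a_grav\<close> and \<open>lam\<close>. The rows are those of the four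
      subsystems, together with the damped real part.\<close>
    have D: "q0 (fst (D x)) = - 2 * c0" "q3 (fst (D x)) = m1 * c1 + m2 * c2 - h * c3"
      "snd (D x) $ 3 = - N33 * v3"
      "lo (D x) = (M21 * v1, - (2 * a_grav) * c2 - N11 * v1)"
      "la (D x) = (- M12 * v2, - (- 2 * a_grav) * c1 - N22 * v2)"
      by (simp_all add: lo_def la_def D_def error_linearization_def Let_def A Lqv Lvv Lqb
          matrix_vector_mult_def sum_3 imq_def vecq_def m1_def m2_def h_def
          c0_def c1_def c2_def c3_def v1_def v2_def v3_def power2_eq_square algebra_simps)
    have Q1: "Q p1 r1 s1 (lo x) (lo (D x)) = - (c2\<^sup>2 + v1\<^sup>2) / 2"
      unfolding D(4) using long_der[of c2 v1]
      by (simp add: Q_def lo_def c2_def v1_def algebra_simps)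
    have Q2: "Q p2 r2 s2 (la x) (la (D x)) = - (c1\<^sup>2 + v2\<^sup>2) / 2"
      unfolding D(5) using lat_der[of c1 v2]
      by (simp add: Q_def la_def c1_def v2_def algebra_simps)
    have "W x (D x) = - 2 * c0\<^sup>2 + (c3 * (m1 * c1) + c3 * (m2 * c2) - h * c3\<^sup>2) - N33 * v3\<^sup>2
        - K / 2 * (c2\<^sup>2 + v1\<^sup>2 + c1\<^sup>2 + v2\<^sup>2)"
      by (simp add: W_def Q1 Q2 D(1-3) c0_def[symmetric] c3_def[symmetric] v3_def[symmetric]
          power2_eq_square field_simps)
    also have "\<dots> \<le> - 2 * c0\<^sup>2 - h / 2 * c3\<^sup>2 - N33 * v3\<^sup>2 - (c2\<^sup>2 + v1\<^sup>2 + c1\<^sup>2 + v2\<^sup>2)"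
    proof -
      have "K / 2 * (c2\<^sup>2 + v1\<^sup>2 + c1\<^sup>2 + v2\<^sup>2) = (m1\<^sup>2 / h) * c1\<^sup>2 + (m2\<^sup>2 / h) * c2\<^sup>2
          + ((m1\<^sup>2 / h) * (c2\<^sup>2 + v1\<^sup>2 + v2\<^sup>2) + (m2\<^sup>2 / h) * (c1\<^sup>2 + v1\<^sup>2 + v2\<^sup>2))
          + (c2\<^sup>2 + v1\<^sup>2 + c1\<^sup>2 + v2\<^sup>2)"
        by (simp add: K_def algebra_simps add_divide_distrib)
      moreover have "(m1\<^sup>2 / h) * (c2\<^sup>2 + v1\<^sup>2 + v2\<^sup>2) \<ge> 0" "(m2\<^sup>2 / h) * (c1\<^sup>2 + v1\<^sup>2 + v2\<^sup>2) \<ge> 0"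
        using h by (simp_all)
      moreover have "c3 * (m1 * c1) \<le> h / 4 * c3\<^sup>2 + (m1\<^sup>2 / h) * c1\<^sup>2"
        "c3 * (m2 * c2) \<le> h / 4 * c3\<^sup>2 + (m2\<^sup>2 / h) * c2\<^sup>2"
        using young[of c3 "m1 * c1"] young[of c3 "m2 * c2"] by (simp_all add: power_mult_distrib)
      moreover have "h / 4 * c3\<^sup>2 + h / 4 * c3\<^sup>2 = h / 2 * c3\<^sup>2" "h / 2 * c3\<^sup>2 + h / 2 * c3\<^sup>2 = h * c3\<^sup>2"
        by simp_all
      ultimately show ?thesis
        by linarith
    qed
    also have "\<dots> < 0"
    proof -
      have "0 < c0\<^sup>2 \<or> 0 < h * c3\<^sup>2 \<or> 0 < N33 * v3\<^sup>2 \<or> 0 < c2\<^sup>2 \<or> 0 < v1\<^sup>2 \<or> 0 < c1\<^sup>2 \<or> 0 < v2\<^sup>2"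
        using nz[OF that] h N33
        by (auto simp: lo_def la_def c0_def c1_def c2_def c3_def v1_def v2_def v3_def)
      moreover have "0 \<le> c0\<^sup>2" "0 \<le> h * c3\<^sup>2" "0 \<le> N33 * v3\<^sup>2" "0 \<le> c2\<^sup>2" "0 \<le> v1\<^sup>2" "0 \<le> c1\<^sup>2" "0 \<le> v2\<^sup>2"
        using h N33 by simp_all
      ultimately show ?thesis by linarith
    qed
    finally show ?thesis .
  qed
  define F where "F y = damped_error_field A B Lqv Lqb Lvv 0 (y + (1, 0))" for y
  have F0: "F 0 = 0"
    by (simp add: F_def damped_error_field_def error_field_def inner_one_quat imq_simps zero_prod_def)
  have F': "(F has_derivative D) (at 0)"
  proof -
    have "((\<lambda>y::state. y + (1, 0)) has_derivative (\<lambda>h. h)) (at 0)"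
      by (auto intro!: derivative_eq_intros)
    moreover have "(damped_error_field A B Lqv Lqb Lvv 0 has_derivative D) (at (0 + (1, 0)))"
      unfolding D_def add_0 by (rule damped_error_field_has_derivative)
    ultimately show ?thesis
      unfolding F_def[abs_def] by (rule has_derivative_compose)
  qed
  \<comment> \<open>Radius 1/2 keeps the quaternion part at norm at least 1/2, away from the
    singularity of the inverse.\<close>
  have "\<exists>L. L-lipschitz_on ((\<lambda>y. y + (1, 0)) ` cball 0 (1/2)) (damped_error_field A B Lqv Lqb Lvv 0)"
  proof (rule damped_error_field_lipschitz[where r = "1/2"])
    show "bounded ((\<lambda>y. y + (1, 0)) ` cball (0 :: state) (1 / 2))"
      using bounded_translation[OF bounded_cball[of "0 :: state" "1/2"], of "(1, 0)"]
      by (simp add: add.commute)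
    fix x :: state assume "x \<in> (\<lambda>y. y + (1, 0)) ` cball 0 (1/2)"
    then obtain y :: state where y: "x = y + (1, 0)" "norm y \<le> 1/2" by auto
    have "norm (fst x - fst y) = 1"
      by (simp add: y(1))
    then have "1 \<le> norm (fst x) + norm (fst y)"
      using norm_triangle_ineq4[of "fst x" "fst y"] by simp
    with y(2) norm_fst_le[of "fst y" "snd y"] show "1 / 2 \<le> norm (fst x)"
      by simp
  qed simp
  then obtain L where "L-lipschitz_on ((\<lambda>y. y + (1, 0)) ` cball 0 (1/2)) (damped_error_field A B Lqv Lqb Lvv 0)" ..
  then have lip: "L-lipschitz_on (cball 0 (1/2)) F"
    by (auto simp: lipschitz_on_def F_def)
  have half: "(0::real) < 1 / 2"
    by simp
  show thesis
  proof (rule lyapunov_exponential_stability[OF F' F0 W sym pos neg half lip])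
    fix \<epsilon> C \<mu> :: real
    assume stable: "\<epsilon> > 0" "C > 0" "\<mu> > 0"
      "\<And>z. norm z < \<epsilon> \<Longrightarrow> \<exists>x. x 0 = z \<and> ode_solution (cball 0 (1/2)) (\<lambda>_. F) x \<and>
         (\<forall>t\<ge>0. norm (x t) \<le> C * exp (- \<mu> * t) * norm z)"
    show thesis
    proof (rule that[OF stable(1-3)])
      fix z :: state assume z: "z \<in> state_space" "dist z (1, 0) < \<epsilon>"
      then obtain x where x: "x 0 = z - (1, 0)" "ode_solution (cball 0 (1/2)) (\<lambda>_. F) x"
        "\<forall>t\<ge>0. norm (x t) \<le> C * exp (- \<mu> * t) * norm (z - (1, 0))"
        using stable(4)[of "z - (1, 0)"] by (auto simp: dist_norm)
      define \<eta> where "\<eta> t = x t + (1, 0)" for t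
      have "ode_solution UNIV (\<lambda>_. damped_error_field A B Lqv Lqb Lvv 0) \<eta>"
        using x(2) unfolding ode_solution_def \<eta>_def F_def
        by (auto intro!: derivative_eq_intros)
      then have "ode_solution state_space (\<lambda>_. error_field A B Lqv Lqb Lvv 0) \<eta>"
        by (rule damped_error_solution) (simp add: \<eta>_def x(1) z(1))
      moreover have "dist (\<eta> t) (1, 0) = norm (x t)" for t
        by (simp add: \<eta>_def dist_norm)
      ultimately show "\<exists>\<eta>. \<eta> 0 = z \<and> ode_solution state_space (\<lambda>_. error_field A B Lqv Lqb Lvv 0) \<eta> \<and>
           (\<forall>t\<ge>0. dist (\<eta> t) (1, 0) \<le> C * exp (- \<mu> * t) * dist z (1, 0))"
        using x(1,3) by (intro exI[of _ \<eta>]) (auto simp: \<eta>_def dist_norm)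
    qed
  qed
qed

section \<open>Lyapunov exponents\<close>

lemma norm_to_body: "norm q = 1 \<Longrightarrow> norm (to_body q h) = norm h"
  using norm_to_earth[of q "to_body q h"] to_earth_to_body[of q h] by fastforce

text \<open>Right translation by a unit quaternion matches the tangent space of the sphere at
  \<open>q\<close> with the imaginary quaternions; this carries the tangency condition of
  \<open>variational_solution\<close> between the frames.\<close>

lemma inner_mult_unit_quat:
  assumes "norm q = 1"
  shows "q \<bullet> (h * q) = q0 h" "q0 (d * inverse q) = q \<bullet> d"
proof -
  have n: "(q0 q)\<^sup>2 + (q1 q)\<^sup>2 + (q2 q)\<^sup>2 + (q3 q)\<^sup>2 = 1"
    using assms by (simp add: norm_quat_def)
  have *: "q0 (d * inverse q) = q \<bullet> d" for d
    by (simp add: inner_quat_def n)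
  then show "q0 (d * inverse q) = q \<bullet> d" .
  show "q \<bullet> (h * q) = q0 h"
  proof -
    have "q \<noteq> 0"
      using assms by auto
    then have "h * q * inverse q = h"
      by (simp add: mult.assoc)
    with *[of "h * q"] show ?thesis
      by (simp only:)
  qed
qed

text \<open>In \<open>observer_field_eq\<close> the estimate enters only linearly and through the
  affine map \<open>inv_error x\<close>. At the true state the error is \<open>(1, 0)\<close>, so
  the chain rule meets the error field exactly at its equilibrium.\<close>

lemma observer_field_has_derivative:
  assumes x: "fst x \<noteq> 0" and y: "y t = system_output B x"
  shows "(observer_field A B Lqv Lqb Lvv Lvb \<omega> a y t has_derivative
     (\<lambda>h. frame_rotation (\<omega> t) h
        + to_body (fst x) (error_linearization A B Lqv Lqb Lvv Lvb (to_earth (fst x) h)))) (at x)"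
proof -
  note lin = linear_frame_rotation linear_to_body linear_to_earth
  note bl = lin[unfolded linear_conv_bounded_linear, THEN bounded_linear.has_derivative]
  have "inv_error x x = (1, 0)"
    using x by (simp add: inv_error_def imq_simps vecq_simps)
  then have e: "(error_field A B Lqv Lqb Lvv Lvb has_derivative error_linearization A B Lqv Lqb Lvv Lvb)
      (at (inv_error x x))"
    using error_field_has_derivative by simp
  have "(inv_error x has_derivative to_earth (fst x)) (at x)"
    unfolding inv_error_eq[abs_def]
    by (rule has_derivative_eq_rhs[OF bl(3)]) (auto intro!: derivative_eq_intros)
  from has_derivative_compose[OF this e]
  have "((\<lambda>z. error_field A B Lqv Lqb Lvv Lvb (inv_error x z)) has_derivative
      (\<lambda>h. error_linearization A B Lqv Lqb Lvv Lvb (to_earth (fst x) h))) (at x)" .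
  then have D: "((\<lambda>z. frame_rotation (\<omega> t) z + (0, vecq (inverse (fst x) * imq A * fst x) + a t)
      + to_body (fst x) (error_field A B Lqv Lqb Lvv Lvb (inv_error x z))) has_derivative
     (\<lambda>h. frame_rotation (\<omega> t) h
        + to_body (fst x) (error_linearization A B Lqv Lqb Lvv Lvb (to_earth (fst x) h)))) (at x)"
    by (auto intro!: derivative_eq_intros bl(1,2))
  \<comment> \<open>\<open>observer_field_eq\<close> requires a nonzero estimated quaternion; this
    is an open condition, which suffices for a derivative at \<open>x\<close>.\<close>
  have "open {z :: state. fst z \<noteq> 0}"
    by (intro open_Collect_neq continuous_intros)
  from has_derivative_transform_within_open[OF D this] show ?thesis
    using x observer_field_eq[where x = x and y = y, OF x _ y] by auto
qed

text \<open>The variational equation along a trajectory, written in the Earth frame, is the variational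
  equation of the error field at its equilibrium.\<close>

lemma variational_to_earth:
  assumes x: "ode_solution state_space (system_field A \<omega> a) x"
    and \<delta>: "variational_solution
       (observer_field A B Lqv Lqb Lvv Lvb \<omega> a (\<lambda>t. system_output B (x t))) x \<delta>"
  shows "variational_solution (\<lambda>_. error_field A B Lqv Lqb Lvv Lvb) (\<lambda>_. (1, 0))
     (\<lambda>t. to_earth (fst (x t)) (\<delta> t))"
  unfolding variational_solution_def
proof (intro allI impI conjI)
  fix t :: real assume t: "t \<ge> 0"
  have S: "x t \<in> state_space"
    using x t by (simp add: ode_solution_def)
  note nz = state_space_nonzero[OF S]
  show "fst (1, 0) \<bullet> fst (to_earth (fst (x t)) (\<delta> t)) = 0"
    using \<delta> t S unfolding to_earth_def fst_conv inner_one_quat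
    by (subst inner_mult_unit_quat) (simp_all add: variational_solution_def state_space_def)
  have "(\<delta> has_vector_derivative frechet_derivative
      (observer_field A B Lqv Lqb Lvv Lvb \<omega> a (\<lambda>t. system_output B (x t)) t) (at (x t)) (\<delta> t)) (at t within {0..})"
    using \<delta> t by (simp add: variational_solution_def)
  then have \<delta>': "(\<delta> has_vector_derivative frame_rotation (\<omega> t) (\<delta> t)
        + to_body (fst (x t)) (error_linearization A B Lqv Lqb Lvv Lvb (to_earth (fst (x t)) (\<delta> t)))) (at t within {0..})"
    unfolding frechet_derivative_at[OF observer_field_has_derivative[OF nz,
        where y = "\<lambda>t. system_output B (x t)" and t = t, OF refl], symmetric] .
  show "((\<lambda>t. to_earth (fst (x t)) (\<delta> t)) has_vector_derivative
      frechet_derivative (error_field A B Lqv Lqb Lvv Lvb) (at (1, 0)) (to_earth (fst (x t)) (\<delta> t))) (at t within {0..})"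
    unfolding frechet_derivative_at[OF error_field_has_derivative, symmetric]
    using to_earth_derivative[OF system_solution_derivatives(1)[OF x t] nz \<delta>']
    by (simp add: to_earth_to_body nz)
qed

lemma variational_to_body:
  assumes x: "ode_solution state_space (system_field A \<omega> a) x"
    and \<zeta>: "variational_solution (\<lambda>_. error_field A B Lqv Lqb Lvv Lvb) (\<lambda>_. (1, 0)) \<zeta>"
  shows "variational_solution
       (observer_field A B Lqv Lqb Lvv Lvb \<omega> a (\<lambda>t. system_output B (x t))) x
       (\<lambda>t. to_body (fst (x t)) (\<zeta> t))"
  unfolding variational_solution_def
proof (intro allI impI conjI)
  fix t :: real assume t: "t \<ge> 0"
  have S: "x t \<in> state_space"
    using x t by (simp add: ode_solution_def)
  note nz = state_space_nonzero[OF S]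
  show "fst (x t) \<bullet> fst (to_body (fst (x t)) (\<zeta> t)) = 0"
    using \<zeta> t S unfolding to_body_def fst_conv
    by (subst inner_mult_unit_quat) (simp_all add: variational_solution_def state_space_def inner_one_quat)
  have "(\<zeta> has_vector_derivative frechet_derivative (error_field A B Lqv Lqb Lvv Lvb) (at (1, 0)) (\<zeta> t))
      (at t within {0..})"
    using \<zeta> t by (simp add: variational_solution_def)
  then have \<zeta>': "(\<zeta> has_vector_derivative error_linearization A B Lqv Lqb Lvv Lvb (\<zeta> t)) (at t within {0..})"
    unfolding frechet_derivative_at[OF error_field_has_derivative, symmetric] .
  show "((\<lambda>t. to_body (fst (x t)) (\<zeta> t)) has_vector_derivative frechet_derivative
      (observer_field A B Lqv Lqb Lvv Lvb \<omega> a (\<lambda>t. system_output B (x t)) t) (at (x t))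
      (to_body (fst (x t)) (\<zeta> t))) (at t within {0..})"
    unfolding frechet_derivative_at[OF observer_field_has_derivative[OF nz,
        where y = "\<lambda>t. system_output B (x t)" and t = t, OF refl], symmetric]
    using to_body_derivative[OF system_solution_derivatives(1)[OF x t] nz \<zeta>']
    by (simp add: to_earth_to_body nz add.commute)
qed

section \<open>Invariance of exponents and multiplicities\<close>

lemma characteristic_exponent_cong:
  assumes "\<And>t. t \<ge> 0 \<Longrightarrow> norm (\<delta> t) = norm (\<zeta> t)"
  shows "characteristic_exponent \<delta> = characteristic_exponent \<zeta>"
  unfolding characteristic_exponent_def
proof (rule Limsup_eq)
  show "\<forall>\<^sub>F t in at_top. ereal (ln (norm (\<delta> t)) / t) = ereal (ln (norm (\<zeta> t)) / t)"
    using eventually_ge_at_top[of 0] by eventually_elim (simp add: assms)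
qed

text \<open>Exponents and multiplicities are read off from the pairs of initial value and exponent.
  The frame change preserves norms, hence exponents, and acts on initial values by one fixed linear
  isomorphism.\<close>

lemma variational_initial_values:
  fixes A B :: "real^3" and Lqv Lqb Lvv Lvb :: "real^3^3"
  assumes x: "ode_solution state_space (system_field A \<omega> a) x"
  defines "F \<equiv> observer_field A B Lqv Lqb Lvv Lvb \<omega> a (\<lambda>t. system_output B (x t))"
    and "data \<equiv> \<lambda>\<delta>::real \<Rightarrow> state. (\<delta> 0, characteristic_exponent \<delta>)"
  shows "data ` Collect (variational_solution F x)
    = map_prod (to_body (fst (x 0))) id `
       data ` Collect (variational_solution (\<lambda>_. error_field A B Lqv Lqb Lvv Lvb) (\<lambda>_. (1, 0)))"
proof -
  have S: "norm (fst (x t)) = 1" "fst (x t) \<noteq> 0" if "t \<ge> 0" for t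
    using x that by (auto simp: ode_solution_def state_space_def)
  have body: "data (\<lambda>t. to_body (fst (x t)) (\<zeta> t)) = map_prod (to_body (fst (x 0))) id (data \<zeta>)" for \<zeta>
    using characteristic_exponent_cong[of "\<lambda>t. to_body (fst (x t)) (\<zeta> t)" \<zeta>]
    by (simp add: data_def norm_to_body S)
  have earth: "map_prod (to_body (fst (x 0))) id (data (\<lambda>t. to_earth (fst (x t)) (\<delta> t))) = data \<delta>" for \<delta>
    using characteristic_exponent_cong[of "\<lambda>t. to_earth (fst (x t)) (\<delta> t)" \<delta>]
    by (simp add: data_def norm_to_earth to_body_to_earth S)
  show ?thesis
    unfolding image_image F_def
  proof (intro equalityI image_subsetI, goal_cases)
    case (1 \<delta>)
    then have "variational_solution (\<lambda>_. error_field A B Lqv Lqb Lvv Lvb) (\<lambda>_. (1, 0))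
        (\<lambda>t. to_earth (fst (x t)) (\<delta> t))"
      by (intro variational_to_earth[OF x]) simp
    then show ?case
      by (intro image_eqI[where x = "\<lambda>t. to_earth (fst (x t)) (\<delta> t)"]) (simp_all add: earth)
  next
    case (2 \<zeta>)
    then have "variational_solution (observer_field A B Lqv Lqb Lvv Lvb \<omega> a (\<lambda>t. system_output B (x t))) x
        (\<lambda>t. to_body (fst (x t)) (\<zeta> t))"
      by (intro variational_to_body[OF x]) simp
    then show ?case
      by (intro image_eqI[where x = "\<lambda>t. to_body (fst (x t)) (\<zeta> t)"]) (simp_all add: body)
  qed
qed

lemma lyapunov_exponents_observer:
  assumes x: "ode_solution state_space (system_field A \<omega> a) x"
  shows "lyapunov_exponents (observer_field A B Lqv Lqb Lvv Lvb \<omega> a (\<lambda>t. system_output B (x t))) x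
    = lyapunov_exponents (\<lambda>_. error_field A B Lqv Lqb Lvv Lvb) (\<lambda>_. (1, 0))"
proof -
  have alt: "lyapunov_exponents F y =
      snd ` {p \<in> (\<lambda>\<delta>. (\<delta> 0, characteristic_exponent \<delta>)) ` Collect (variational_solution F y). fst p \<noteq> 0}"
    for F y
    by (simp add: lyapunov_exponents_def Compr_image_eq image_image setcompr_eq_image)
  have nz: "fst (x 0) \<noteq> 0"
    using x by (auto simp: ode_solution_def state_space_def)
  have zero: "to_body (fst (x 0)) h = 0 \<longleftrightarrow> h = 0" for h
    using to_earth_to_body[OF nz, of h] linear_0[OF linear_to_body] linear_0[OF linear_to_earth] by metis
  have "snd ` {p \<in> map_prod (to_body (fst (x 0))) id ` V. fst p \<noteq> 0} = snd ` {p \<in> V. fst p \<noteq> 0}"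
    for V :: "(state \<times> ereal) set"
    by (simp add: Compr_image_eq image_image zero)
  then show ?thesis
    unfolding alt variational_initial_values[OF x] by simp
qed

text \<open>Each level of the Lyapunov filtration along the trajectory is the image of the
  corresponding level at the equilibrium under an injective linear map, so the dimensions
  agree.\<close>

lemma lyapunov_multiplicity_observer:
  assumes x: "ode_solution state_space (system_field A \<omega> a) x"
  shows "lyapunov_multiplicity (observer_field A B Lqv Lqb Lvv Lvb \<omega> a (\<lambda>t. system_output B (x t))) x
    = lyapunov_multiplicity (\<lambda>_. error_field A B Lqv Lqb Lvv Lvb) (\<lambda>_. (1, 0))"
proof -
  have alt: "{\<delta> 0 | \<delta>. variational_solution F y \<delta> \<and> (\<delta> 0 = 0 \<or> P (characteristic_exponent \<delta>))} =
      fst ` {p \<in> (\<lambda>\<delta>. (\<delta> 0, characteristic_exponent \<delta>)) ` Collect (variational_solution F y).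
        fst p = 0 \<or> P (snd p)}"
    for F y P
    by (simp add: Compr_image_eq image_image setcompr_eq_image)
  have nz: "fst (x 0) \<noteq> 0"
    using x by (auto simp: ode_solution_def state_space_def)
  have inj: "inj (to_body (fst (x 0)))"
    using to_earth_to_body[OF nz] by (rule inj_on_inverseI)
  have zero: "to_body (fst (x 0)) h = 0 \<longleftrightarrow> h = 0" for h
    using inj linear_0[OF linear_to_body] by (metis injD)
  have image: "fst ` {p \<in> map_prod (to_body (fst (x 0))) id ` V. fst p = 0 \<or> P (snd p)}
      = to_body (fst (x 0)) ` fst ` {p \<in> V. fst p = 0 \<or> P (snd p)}"
    for V :: "(state \<times> ereal) set" and P
    by (simp add: Compr_image_eq image_image zero)
  have dim: "dim (to_body (fst (x 0)) ` V) = dim V" for V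
    using inj by (intro dim_image_eq[OF linear_to_body]) (auto intro: inj_on_subset)
  have "dim {\<delta> 0 | \<delta>. variational_solution
        (observer_field A B Lqv Lqb Lvv Lvb \<omega> a (\<lambda>t. system_output B (x t))) x \<delta> \<and>
        (\<delta> 0 = 0 \<or> P (characteristic_exponent \<delta>))}
    = dim {\<zeta> 0 | \<zeta>. variational_solution (\<lambda>_. error_field A B Lqv Lqb Lvv Lvb) (\<lambda>_. (1, 0)) \<zeta> \<and>
        (\<zeta> 0 = 0 \<or> P (characteristic_exponent \<zeta>))}" for P
    unfolding alt variational_initial_values[OF x] image dim ..
  from this[of "\<lambda>e. e \<le> c" for c] this[of "\<lambda>e. e < c" for c] show ?thesis
    by (simp add: lyapunov_multiplicity_def fun_eq_iff)
qed

section \<open>The convergence theorem\<close>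

theorem theorem6:
  fixes a_grav M12 M21 N11 N22 N33 lam :: real
    and A B :: "real^3"
    and Lqv Lqb Lvv Lvb :: "real^3^3"
    and observer :: "(real \<Rightarrow> real^3) \<Rightarrow> (real \<Rightarrow> real^3) \<Rightarrow> (real \<Rightarrow> state) \<Rightarrow> real \<Rightarrow> state \<Rightarrow> state"
    and trajectory :: "(real \<Rightarrow> real^3) \<Rightarrow> (real \<Rightarrow> real^3) \<Rightarrow> (real \<Rightarrow> state) \<Rightarrow> bool"
  assumes A: "A = vector [0, 0, a_grav]"
    and Lqv: "Lqv = vector [vector [0, - M12, 0], vector [M21, 0, 0], vector [0, 0, 0]]"
    and Lvv: "Lvv = - vector [vector [N11, 0, 0], vector [0, N22, 0], vector [0, 0, N33]]"
    and Lqb: "Lqb = vector [vector [0, 0, 0], vector [0, 0, 0], vector [- lam * B$2, lam * B$1, 0]]"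
    and Lvb: "Lvb = 0"
    and longitudinal: "asymptotically_stable (longitudinal_field a_grav M21 N11)"
    and lateral: "asymptotically_stable (lateral_field a_grav M12 N22)"
    and vertical: "asymptotically_stable (vertical_field N33)"
    and heading: "asymptotically_stable (heading_field B lam 0 0)"
    and trajectory: "\<And>\<omega> a x. trajectory \<omega> a x \<longleftrightarrow> ode_solution state_space (system_field A \<omega> a) x"
    and observer: "\<And>\<omega> a x. observer \<omega> a x =
          observer_field A B Lqv Lqb Lvv Lvb \<omega> a (\<lambda>t. system_output B (x t))"
  shows
    "(\<exists>\<epsilon>>0. \<exists>C>0. \<exists>\<mu>>0. \<forall>\<omega> a x. trajectory \<omega> a x \<longrightarrow>
        exp_convergent_around \<epsilon> C \<mu> (observer \<omega> a x) x)
     \<and> (\<forall>\<omega> a x xh. trajectory \<omega> a x \<and> ode_solution state_space (observer \<omega> a x) xh \<longrightarrow>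
          ode_solution state_space (\<lambda>_. error_field A B Lqv Lqb Lvv Lvb)
            (\<lambda>t. inv_error (x t) (xh t)))
     \<and> (\<forall>\<omega> a x \<omega>' a' x'. trajectory \<omega> a x \<and> trajectory \<omega>' a' x' \<longrightarrow>
          (\<forall>xh. ode_solution state_space (observer \<omega> a x) xh \<longrightarrow>
             (\<exists>xh'. ode_solution state_space (observer \<omega>' a' x') xh' \<and>
                inv_error (x' 0) (xh' 0) = inv_error (x 0) (xh 0)) \<and>
             (\<forall>xh'. ode_solution state_space (observer \<omega>' a' x') xh' \<and>
                inv_error (x' 0) (xh' 0) = inv_error (x 0) (xh 0) \<longrightarrow>
                (\<forall>t\<ge>0. inv_error (x' t) (xh' t) = inv_error (x t) (xh t))))
          \<and> lyapunov_exponents (observer \<omega>' a' x') x' = lyapunov_exponents (observer \<omega> a x) x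
          \<and> lyapunov_multiplicity (observer \<omega>' a' x') x' = lyapunov_multiplicity (observer \<omega> a x) x)"
proof (intro conjI)
  let ?e = "error_field A B Lqv Lqb Lvv Lvb"
  have S: "x t \<in> state_space" if "trajectory \<omega> a x" "t \<ge> 0" for \<omega> a x t
    using that by (simp add: trajectory ode_solution_def)
  have error: "ode_solution state_space (\<lambda>_. ?e) (\<lambda>t. inv_error (x t) (xh t))"
    if "trajectory \<omega> a x" "ode_solution state_space (observer \<omega> a x) xh" for \<omega> a x xh
    using that unfolding trajectory observer by (rule observer_solution_error)
  have estimate: "ode_solution state_space (observer \<omega> a x) (\<lambda>t. estimate_of (x t) (\<eta> t))"
    if "trajectory \<omega> a x" "ode_solution state_space (\<lambda>_. ?e) \<eta>" for \<omega> a x \<eta>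
    using that unfolding trajectory observer by (rule error_solution_estimate)
  show "\<forall>\<omega> a x xh. trajectory \<omega> a x \<and> ode_solution state_space (observer \<omega> a x) xh \<longrightarrow>
      ode_solution state_space (\<lambda>_. ?e) (\<lambda>t. inv_error (x t) (xh t))"
    using error by blast
  show "\<exists>\<epsilon>>0. \<exists>C>0. \<exists>\<mu>>0. \<forall>\<omega> a x. trajectory \<omega> a x \<longrightarrow>
        exp_convergent_around \<epsilon> C \<mu> (observer \<omega> a x) x"
  \<comment> \<open>The three constants are fixed before any trajectory or input is introduced,
    which gives their uniformity.\<close>
  proof (rule error_field_exponentially_stable[OF A Lqv Lvv Lqb longitudinal lateral vertical heading,
        folded Lvb])
    fix \<epsilon> C \<mu> :: real
    assume pos: "\<epsilon> > 0" "C > 0" "\<mu> > 0"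
      and stable: "\<And>z. z \<in> state_space \<Longrightarrow> dist z (1, 0) < \<epsilon> \<Longrightarrow>
       \<exists>\<eta>. \<eta> 0 = z \<and> ode_solution state_space (\<lambda>_. ?e) \<eta> \<and>
         (\<forall>t\<ge>0. dist (\<eta> t) (1, 0) \<le> C * exp (- \<mu> * t) * dist z (1, 0))"
    have "exp_convergent_around \<epsilon> C \<mu> (observer \<omega> a x) x" if x: "trajectory \<omega> a x" for \<omega> a x
      unfolding exp_convergent_around_def
    proof (intro conjI ballI allI impI)
      note x0 = S[OF x order_refl]
      fix z assume z: "z \<in> state_space" "dist (inv_error (x 0) z) (1, 0) < \<epsilon>"
      obtain \<eta> where \<eta>: "\<eta> 0 = inv_error (x 0) z" "ode_solution state_space (\<lambda>_. ?e) \<eta>"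
        using stable[OF inv_error_in_state_space[OF x0 z(1)] z(2)] by blast
      show "\<exists>xh. ode_solution state_space (observer \<omega> a x) xh \<and> xh 0 = z"
        using estimate[OF x \<eta>(2)] \<eta>(1) estimate_of_inv_error[OF state_space_nonzero[OF x0]]
        by (intro exI[of _ "\<lambda>t. estimate_of (x t) (\<eta> t)"]) simp
    next
      fix xh and t :: real
      assume xh: "ode_solution state_space (observer \<omega> a x) xh \<and> dist (inv_error (x 0) (xh 0)) (1, 0) < \<epsilon>"
        and t: "0 \<le> t"
      note e = error[OF x conjunct1[OF xh]]
      have "inv_error (x 0) (xh 0) \<in> state_space"
        using e by (simp add: ode_solution_def)
      \<comment> \<open>Stability supplies one decaying error solution with this initial value; by
        uniqueness it is the error of the given \<open>xh\<close>.\<close>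
      then obtain \<eta> where \<eta>: "\<eta> 0 = inv_error (x 0) (xh 0)" "ode_solution state_space (\<lambda>_. ?e) \<eta>"
        "\<forall>t\<ge>0. dist (\<eta> t) (1, 0) \<le> C * exp (- \<mu> * t) * dist (inv_error (x 0) (xh 0)) (1, 0)"
        using stable[OF _ conjunct2[OF xh]] by blast
      then show "dist (inv_error (x t) (xh t)) (1, 0)
          \<le> C * exp (- \<mu> * t) * dist (inv_error (x 0) (xh 0)) (1, 0)"
        using error_solution_unique[OF \<eta>(2) e \<eta>(1) t] t by metis
    qed
    then show ?thesis
      using pos by blast
  qed
  show "\<forall>\<omega> a x \<omega>' a' x'. trajectory \<omega> a x \<and> trajectory \<omega>' a' x' \<longrightarrow>
          (\<forall>xh. ode_solution state_space (observer \<omega> a x) xh \<longrightarrow>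
             (\<exists>xh'. ode_solution state_space (observer \<omega>' a' x') xh' \<and>
                inv_error (x' 0) (xh' 0) = inv_error (x 0) (xh 0)) \<and>
             (\<forall>xh'. ode_solution state_space (observer \<omega>' a' x') xh' \<and>
                inv_error (x' 0) (xh' 0) = inv_error (x 0) (xh 0) \<longrightarrow>
                (\<forall>t\<ge>0. inv_error (x' t) (xh' t) = inv_error (x t) (xh t))))
          \<and> lyapunov_exponents (observer \<omega>' a' x') x' = lyapunov_exponents (observer \<omega> a x) x
          \<and> lyapunov_multiplicity (observer \<omega>' a' x') x' = lyapunov_multiplicity (observer \<omega> a x) x"
  proof (intro allI impI, elim conjE, intro conjI allI impI, goal_cases)
    case (1 \<omega> a x \<omega>' a' x' xh)
    \<comment> \<open>The error history of the first observer, transported along the second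
      trajectory, is the required \<open>xh'\<close>.\<close>
    have "inv_error (x' 0) (estimate_of (x' 0) (inv_error (x 0) (xh 0))) = inv_error (x 0) (xh 0)"
      by (intro inv_error_estimate_of state_space_nonzero S[OF 1(2) order_refl])
    with estimate[OF 1(2) error[OF 1(1,3)]] show ?case
      by blast
  next
    case (2 \<omega> a x \<omega>' a' x' xh xh' t)
    then show ?case
      using error_solution_unique[OF error[of \<omega>' a' x' xh'] error[of \<omega> a x xh]] by blast
  next
    case (3 \<omega> a x \<omega>' a' x')
    then show ?case
      unfolding trajectory observer by (simp add: lyapunov_exponents_observer)
  next
    case (4 \<omega> a x \<omega>' a' x')
    then show ?case
      unfolding trajectory observer by (simp add: lyapunov_multiplicity_observer)
  qed
qed

end
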